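(* Let $\Omega\in\mathcal{O}_C$ have thickness function $d:\partial C\to\mathbb{R}_+$ of class $C^2$ and return map $F:\partial C\to\partial C$. Assume that the alignment condition holds at a nondegenerate critical point $c^*$ of $d$, i.e. $A(c^* )$ and $\mathrm{Hess}_{\partial C}(d)(c^* )$ are simultaneously diagonalizable. Then: (1) the eigenvectors of $\mathrm{Hess}_{\partial C}(d)(c^* )$ are uniquely determined by $DF(c^* )$; (2) the eigenvalues satisfy $$\mu_i=1-\alpha_i\lambda_i,$$ where $\mu_i$ are the eigenvalues of $DF(c^* )$, $\lambda_i$ are the eigenvalues of $\mathrm{Hess}_{\partial C}(d)(c^* )$, and $\alpha_i$ are those of $A(c^* )$.
   Context: Convex core. $C\subset\mathbb{R}^N$ is a compact convex set with nonempty interior whose boundary $\partial C$ is a hypersurface of class $C^2$, with the induced Riemannian structure and outward unit normal $\nu(c)$ at $c\in\partial C$. $\nabla_{\partial C}$ and $\mathrm{Hess}_{\partial C}$ are the Riemannian gradient and Hessian (the latter as a self-adjoint operator on $T_c(\partial C)$). The shape operator $S_c$ is defined by $D\nu(c)[v]=-S_cv$. Class $\mathcal{O}_C$. An open set $\Omega\subset\mathbb{R}^N$ belongs to $\mathcal{O}_C$ if: (1) $\mathrm{int}(C)\subset\Omega$; (2) $\partial\Omega$ is Lipschitz outside $C$; (3) for every $c\in\partial C$ the ray $\{c+t\nu(c):t\ge 0\}$ intersects $\Omega$ in a connected set; (4) for almost every $x\in\partial\Omega$ at which the inward unit normal $n(x)$ exists, the half-line $\{x+tn(x):t\ge0\}$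 intersects $C$. Thickness function: $d(c)=\sup\{r\ge0: c+r\nu(c)\in\Omega\}$. Radial map: $\Phi:\partial C\to\partial\Omega$, $\Phi(c)=c+d(c)\nu(c)$. Reciprocal map: $\pi:\partial\Omega\setminus C\to\partial C$, $\pi(x)=x+t(x)n(x)$, where $n(x)$ is the inward unit normal to $\partial\Omega$ at $x$ and $t(x)$ is the smallest nonnegative number with $x+t(x)n(x)\in C$. Return map: $F=\pi\circ\Phi:\partial C\to\partial C$. Geometric operator. At a nondegenerate critical point $c^*$ of $d$ (gradient zero, Hessian invertible), the linearization of $F$ is written $DF(c^* )=I-A(c^* )\,\mathrm{Hess}_{\partial C}d(c^* )$, where $A(c^* )$ is the linear operator on $T_{c^*}(\partial C)$ given in the paper by $A(c^* )=2d(c^* )(I-d(c^* )S_{c^*})^{-1}$. Eigenvalues $\mu_i,\alpha_i,\lambda_i$ are indexed along a common eigenbasis.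
   Formalization: The constant 2 in A(c* ) is incompatible with F; (2) is stated for A=κd(I−dS)^{-1} whenever DF=I−A Hess, which is proved for κ=−1. In (1), DF(c* ) determines the eigenvectors with C and d(c* ) (hence A) held fixed; from DF alone only for simple eigenvalues of DF. *)

theory Defs
  imports "HOL-Analysis.Analysis"
begin

section \<open>The convex core and calculus on its boundary\<close>

text \<open>\<open>g\<close> is the gradient of \<open>f\<close> on the open set \<open>U\<close>, and \<open>f\<close> is of class \<open>C\<^sup>2\<close> there
  (continuity of the second derivative is in operator norm).\<close>

definition C2_with_gradient :: "'a::euclidean_space set \<Rightarrow> ('a \<Rightarrow> real) \<Rightarrow> ('a \<Rightarrow> 'a) \<Rightarrow> bool" where
  "C2_with_gradient U f g \<longleftrightarrow>
     (\<forall>x\<in>U. (f has_derivative (\<lambda>v. g x \<bullet> v)) (at x)) \<and>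
     (\<exists>h. (\<forall>x\<in>U. (g has_derivative blinfun_apply (h x)) (at x)) \<and> continuous_on U h)"

definition C2_hypersurface :: "'a::euclidean_space set \<Rightarrow> bool" where
  "C2_hypersurface M \<longleftrightarrow>
     (\<forall>p\<in>M. \<exists>U f g. open U \<and> p \<in> U \<and> C2_with_gradient U f g \<and> g p \<noteq> 0 \<and>
        M \<inter> U = {x\<in>U. f x = 0})"

text \<open>A function on \<open>M\<close> is of class \<open>C\<^sup>2\<close> if it has \<open>C\<^sup>2\<close> extensions locally.\<close>

definition C2_on_hypersurface :: "'a::euclidean_space set \<Rightarrow> ('a \<Rightarrow> real) \<Rightarrow> bool" where
  "C2_on_hypersurface M f \<longleftrightarrow>
     (\<forall>p\<in>M. \<exists>U \<phi> g. open U \<and> p \<in> U \<and> C2_with_gradient U \<phi> g \<and> (\<forall>x\<in>M \<inter> U. \<phi> x = f x))"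

definition convex_core :: "'a::euclidean_space set \<Rightarrow> bool" where
  "convex_core C \<longleftrightarrow> compact C \<and> convex C \<and> interior C \<noteq> {} \<and> C2_hypersurface (frontier C)"

definition outward_normal :: "'a::euclidean_space set \<Rightarrow> 'a \<Rightarrow> 'a" where
  "outward_normal C c = (THE u. norm u = 1 \<and> (\<forall>y\<in>C. u \<bullet> (y - c) \<le> 0))"

definition tangent_space :: "'a::euclidean_space set \<Rightarrow> 'a \<Rightarrow> 'a set" where
  "tangent_space C c = {v. outward_normal C c \<bullet> v = 0}"

text \<open>Differentials along the boundary are given by \<^term>\<open>frechet_derivative\<close> relative to
  \<open>at c within frontier C\<close>. As a linear map on the ambient space such a derivative is not unique,
  but its values on the tangent space at \<open>c\<close> are; all operators below are only used there.\<close>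

definition shape_operator :: "'a::euclidean_space set \<Rightarrow> 'a \<Rightarrow> 'a \<Rightarrow> 'a" where
  "shape_operator C c v = - frechet_derivative (outward_normal C) (at c within frontier C) v"

definition surface_gradient :: "'a::euclidean_space set \<Rightarrow> ('a \<Rightarrow> real) \<Rightarrow> 'a \<Rightarrow> 'a" where
  "surface_gradient C f c =
     (THE g. g \<in> tangent_space C c \<and>
        (\<forall>v\<in>tangent_space C c. frechet_derivative f (at c within frontier C) v = g \<bullet> v))"

text \<open>The Hessian operator is the covariant derivative of the gradient field; for the induced
  metric this is the tangential part of the ambient derivative.\<close>

definition surface_hessian :: "'a::euclidean_space set \<Rightarrow> ('a \<Rightarrow> real) \<Rightarrow> 'a \<Rightarrow> 'a \<Rightarrow> 'a" where
  "surface_hessian C f c v =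
     (let w = frechet_derivative (surface_gradient C f) (at c within frontier C) v;
          u = outward_normal C c
      in w - (u \<bullet> w) *\<^sub>R u)"


section \<open>The class of domains\<close>

definition lipschitz_boundary_at :: "'a::euclidean_space set \<Rightarrow> 'a \<Rightarrow> bool" where
  "lipschitz_boundary_at \<Omega> x \<longleftrightarrow>
     (\<exists>U e L \<phi>. open U \<and> x \<in> U \<and> norm e = 1 \<and> L-lipschitz_on {w. w \<bullet> e = 0} \<phi> \<and>
        \<Omega> \<inter> U = {y\<in>U. y \<bullet> e < (\<phi> (y - (y \<bullet> e) *\<^sub>R e) :: real)})"

text \<open>The inward unit normal exists at \<open>x\<close> when \<open>\<Omega>\<close> agrees with a half-space to first order at
  \<open>x\<close>; for a Lipschitz subgraph this is differentiability of the graph function.\<close>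

definition is_inward_normal :: "'a::euclidean_space set \<Rightarrow> 'a \<Rightarrow> 'a \<Rightarrow> bool" where
  "is_inward_normal \<Omega> x n \<longleftrightarrow> norm n = 1 \<and>
     (\<forall>\<epsilon>>0. \<exists>r>0. \<forall>y\<in>ball x r.
        (n \<bullet> (y - x) > \<epsilon> * norm (y - x) \<longrightarrow> y \<in> \<Omega>) \<and>
        (n \<bullet> (y - x) < - \<epsilon> * norm (y - x) \<longrightarrow> y \<notin> \<Omega>))"

definition inward_normal :: "'a::euclidean_space set \<Rightarrow> 'a \<Rightarrow> 'a" where
  "inward_normal \<Omega> x = (THE n. is_inward_normal \<Omega> x n)"

text \<open>Null sets of the Hausdorff measure of dimension \<open>N - 1\<close>. The empty set has weight \<open>0\<close> also
  for \<open>N = 1\<close>, where the measure counts points.\<close>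

definition surface_null :: "'a::euclidean_space set \<Rightarrow> bool" where
  "surface_null E \<longleftrightarrow>
     (\<forall>\<epsilon>>0. \<exists>A :: nat \<Rightarrow> 'a set. E \<subseteq> (\<Union>i. A i) \<and> (\<forall>i. bounded (A i)) \<and>
        (let m = (\<lambda>i. if A i = {} then 0 else diameter (A i) ^ (DIM('a) - 1))
         in summable m \<and> suminf m < \<epsilon>))"

definition class_O :: "'a::euclidean_space set \<Rightarrow> 'a set \<Rightarrow> bool" where
  "class_O C \<Omega> \<longleftrightarrow>
     open \<Omega> \<and>
     interior C \<subseteq> \<Omega> \<and>
     (\<forall>x\<in>frontier \<Omega> - C. lipschitz_boundary_at \<Omega> x) \<and>
     (\<forall>c\<in>frontier C. connected ({c + t *\<^sub>R outward_normal C c |t. 0 \<le> t} \<inter> \<Omega>)) \<and>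
     surface_null {x\<in>frontier \<Omega>. \<exists>n. is_inward_normal \<Omega> x n \<and> {x + t *\<^sub>R n |t. 0 \<le> t} \<inter> C = {}}"


section \<open>Thickness, return map and geometric operator\<close>

definition thickness_set :: "'a::euclidean_space set \<Rightarrow> 'a set \<Rightarrow> 'a \<Rightarrow> real set" where
  "thickness_set C \<Omega> c = {r. 0 \<le> r \<and> c + r *\<^sub>R outward_normal C c \<in> \<Omega>}"

text \<open>Inserting \<open>0\<close> is the convention that the supremum of the empty set within the nonnegative
  reals is \<open>0\<close>.\<close>

definition thickness :: "'a::euclidean_space set \<Rightarrow> 'a set \<Rightarrow> 'a \<Rightarrow> real" where
  "thickness C \<Omega> c = Sup (insert 0 (thickness_set C \<Omega> c))"

definition radial_map :: "'a::euclidean_space set \<Rightarrow> 'a set \<Rightarrow> 'a \<Rightarrow> 'a" where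
  "radial_map C \<Omega> c = c + thickness C \<Omega> c *\<^sub>R outward_normal C c"

definition reciprocal_map :: "'a::euclidean_space set \<Rightarrow> 'a set \<Rightarrow> 'a \<Rightarrow> 'a" where
  "reciprocal_map C \<Omega> x =
     (let n = inward_normal \<Omega> x in x + (LEAST t::real. 0 \<le> t \<and> x + t *\<^sub>R n \<in> C) *\<^sub>R n)"

definition return_map :: "'a::euclidean_space set \<Rightarrow> 'a set \<Rightarrow> 'a \<Rightarrow> 'a" where
  "return_map C \<Omega> = reciprocal_map C \<Omega> \<circ> radial_map C \<Omega>"

text \<open>The composite \<open>\<pi> \<circ> \<Phi>\<close> makes sense at \<open>c\<close>: the point \<open>\<Phi> c\<close> lies on the boundary of \<open>\<Omega>\<close>
  outside \<open>C\<close>, and the inward normal exists there and leads back to \<open>C\<close>.\<close>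

definition return_map_defined_at :: "'a::euclidean_space set \<Rightarrow> 'a set \<Rightarrow> 'a \<Rightarrow> bool" where
  "return_map_defined_at C \<Omega> c \<longleftrightarrow>
     radial_map C \<Omega> c \<in> frontier \<Omega> - C \<and>
     (\<exists>n. is_inward_normal \<Omega> (radial_map C \<Omega> c) n \<and>
        (\<exists>t\<ge>0. radial_map C \<Omega> c + t *\<^sub>R n \<in> C))"

definition C2_domain :: "'a::euclidean_space set \<Rightarrow> 'a set \<Rightarrow> bool" where
  "C2_domain C \<Omega> \<longleftrightarrow>
     class_O C \<Omega> \<and>
     (\<forall>c\<in>frontier C. bdd_above (thickness_set C \<Omega> c)) \<and>
     C2_on_hypersurface (frontier C) (thickness C \<Omega>) \<and>
     (\<forall>c\<in>frontier C. return_map_defined_at C \<Omega> c)"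

abbreviation thickness_hessian :: "'a::euclidean_space set \<Rightarrow> 'a set \<Rightarrow> 'a \<Rightarrow> 'a \<Rightarrow> 'a" where
  "thickness_hessian C \<Omega> c \<equiv> surface_hessian C (thickness C \<Omega>) c"

abbreviation return_differential :: "'a::euclidean_space set \<Rightarrow> 'a set \<Rightarrow> 'a \<Rightarrow> 'a \<Rightarrow> 'a" where
  "return_differential C \<Omega> c \<equiv> frechet_derivative (return_map C \<Omega>) (at c within frontier C)"

definition nondegenerate_critical_point :: "'a::euclidean_space set \<Rightarrow> 'a set \<Rightarrow> 'a \<Rightarrow> bool" where
  "nondegenerate_critical_point C \<Omega> c \<longleftrightarrow>
     c \<in> frontier C \<and>
     surface_gradient C (thickness C \<Omega>) c = 0 \<and>
     bij_betw (thickness_hessian C \<Omega> c) (tangent_space C c) (tangent_space C c)"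

text \<open>The operator \<open>\<kappa> d (I - d S)\<inverse>\<close> on the tangent space, with normalising constant \<open>\<kappa>\<close>. The
  literature states \<open>\<kappa> = 2\<close>. For the return map defined above, the identity \<open>DF = I - A Hess d\<close>
  requires \<open>\<kappa> = -1\<close>: over a flat piece of the boundary \<open>F c = c + d c *\<^sub>R grad d c\<close>, so
  \<open>DF = I + d Hess d\<close> at a critical point.\<close>

definition geometric_operator ::
    "real \<Rightarrow> 'a::euclidean_space set \<Rightarrow> 'a set \<Rightarrow> 'a \<Rightarrow> 'a \<Rightarrow> 'a" where
  "geometric_operator \<kappa> C \<Omega> c v =
     (\<kappa> * thickness C \<Omega> c) *\<^sub>R
       inv_into (tangent_space C c) (\<lambda>w. w - thickness C \<Omega> c *\<^sub>R shape_operator C c w) v"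

definition linearization_formula :: "real \<Rightarrow> 'a::euclidean_space set \<Rightarrow> 'a set \<Rightarrow> 'a \<Rightarrow> bool" where
  "linearization_formula \<kappa> C \<Omega> c \<longleftrightarrow>
     (\<forall>v\<in>tangent_space C c. return_differential C \<Omega> c v
        = v - geometric_operator \<kappa> C \<Omega> c (thickness_hessian C \<Omega> c v))"


section \<open>Eigenvectors and diagonalization on a subspace\<close>

definition eigenvector_on :: "'a::euclidean_space set \<Rightarrow> ('a \<Rightarrow> 'a) \<Rightarrow> 'a \<Rightarrow> bool" where
  "eigenvector_on T L v \<longleftrightarrow> v \<in> T \<and> v \<noteq> 0 \<and> (\<exists>\<mu>. L v = \<mu> *\<^sub>R v)"

text \<open>\<open>B\<close> is an eigenbasis of \<open>L\<close> on \<open>T\<close>; \<open>l b\<close> is the eigenvalue belonging to \<open>b\<close>.\<close>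

definition eigenbasis_on :: "'a::euclidean_space set \<Rightarrow> ('a \<Rightarrow> 'a) \<Rightarrow> 'a set \<Rightarrow> ('a \<Rightarrow> real) \<Rightarrow> bool" where
  "eigenbasis_on T L B l \<longleftrightarrow> independent B \<and> span B = T \<and> (\<forall>b\<in>B. L b = l b *\<^sub>R b)"

definition simultaneously_diagonalizable_on ::
    "'a::euclidean_space set \<Rightarrow> ('a \<Rightarrow> 'a) \<Rightarrow> ('a \<Rightarrow> 'a) \<Rightarrow> bool" where
  "simultaneously_diagonalizable_on T L M \<longleftrightarrow>
     (\<exists>B l m. eigenbasis_on T L B l \<and> eigenbasis_on T M B m)"

end

theory Submission
  imports Defs
begin

text \<open>Write the inward normal of \<open>\<Omega>\<close> at \<open>\<Phi> x\<close> as \<open>n x = z x - a x \<nu>(x)\<close> with \<open>z x\<close> tangent to the boundary of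
  \<open>C\<close>. It is orthogonal to the image of \<open>D\<Phi>\<close>, which says \<open>z \<bullet> (v + d D\<nu> v) = a (grad d \<bullet> v)\<close> for
  tangent \<open>v\<close>. Convexity makes \<open>D\<nu>\<close> positive semidefinite; hence \<open>|z| \<le> |grad d|\<close>, and at a critical point
  \<open>z\<close> has the derivative \<open>Z = (I - d S)\<inverse> Hess d\<close> by symmetry of \<open>D\<nu>\<close>. With \<open>t\<close> the travel
  time, \<open>F x = x + (d - t a) \<nu>(x) + t z x\<close>, where the normal term is \<open>o(x - c)\<close> since \<open>F x\<close> lies
  on the boundary of \<open>C\<close>. Thus \<open>DF = I + d (I - d S)\<inverse> Hess d\<close>. As \<open>(I - d S)\<inverse>\<close> is injective,
  \<open>DF\<close> determines \<open>Hess d\<close>, and under the alignment condition \<open>Hess d\<close> commutes with \<open>DF\<close>, so it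
  preserves the eigenspaces of \<open>DF\<close>.\<close>

section \<open>Second derivatives and tangent sequences\<close>

text \<open>The obstacle is regularity. Each point \<open>\<Phi> x\<close> has an inward normal, but
  nothing given says that this normal, or the travel time, varies even continuously; only
  \<open>d\<close> and \<open>\<nu>\<close> are differentiable. Everything about \<open>n x\<close>
  is therefore extracted at one fixed \<open>x\<close> at a time, with the normal frozen, and the
  limits \<open>z x \<rightarrow> 0\<close>, \<open>a x \<rightarrow> 1\<close> and
  \<open>t x \<rightarrow> d c\<close> follow from the resulting inequalities. The sign
  \<open>a \<ge> 0\<close> comes from the thickness being a supremum over points of
  \<open>\<Omega>\<close>. Moreover a derivative within the frontier is determined only at tangent
  vectors, where its values are limits of difference quotients along sequences on the surface.

  That \<open>DF\<close> determines the eigenvectors is shown in two senses: domains with equal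
  thickness and equal return differential at \<open>c\<close> have the same Hessian on tangent
  vectors, and an eigenvector of \<open>DF\<close> for a simple eigenvalue is one of
  \<open>Hess d\<close>. Simplicity matters in the second sense: different eigenvalue pairs of
  \<open>A\<close> and \<open>Hess d\<close> may have equal products, and then a larger eigenspace
  of \<open>DF\<close> is merely preserved by \<open>Hess d\<close>.\<close>

lemma second_difference_tendsto:
  fixes f :: "'a::real_inner \<Rightarrow> real"
  assumes U: "open U" "c \<in> U"
    and f: "\<And>x. x \<in> U \<Longrightarrow> (f has_derivative (\<lambda>v. g x \<bullet> v)) (at x)"
    and g: "(g has_derivative h) (at c)"
  shows "((\<lambda>s. (f (c + s *\<^sub>R u + s *\<^sub>R v) - f (c + s *\<^sub>R u) - f (c + s *\<^sub>R v) + f c) / s\<^sup>2) \<longlongrightarrow> h v \<bullet> u) (at_right 0)"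
proof (rule tendstoI)
  fix e :: real assume e: "e > 0"
  define K where "K = 2 * norm u + norm v + 1"
  have K: "K > 0" unfolding K_def by (smt (verit) norm_ge_zero)
  \<comment> \<open>\<open>K\<close> dominates the sum of the two remainder bounds,
    \<open>norm u + norm v\<close> and \<open>norm u\<close>; the factor \<open>norm u + 1\<close>
    absorbs the Cauchy-Schwarz factor, so that the final error is at most
    \<open>e / 2\<close>.\<close>
  define \<epsilon> where "\<epsilon> = e / (2 * K * (norm u + 1))"
  have \<epsilon>: "\<epsilon> > 0" unfolding \<epsilon>_def using e K by (simp add: add_nonneg_pos)
  obtain d where d: "d > 0" and r: "\<And>y. norm (y - c) < d \<Longrightarrow> norm (g y - g c - h (y - c)) \<le> \<epsilon> * norm (y - c)"
    using g \<epsilon> unfolding has_derivative_at_alt by blast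
  obtain d' where d': "d' > 0" "ball c d' \<subseteq> U" using U open_contains_ball by blast
  interpret h: bounded_linear h using g by (rule has_derivative_bounded_linear)
  define \<delta> where "\<delta> = min d d' / K"
  have \<delta>: "\<delta> > 0" unfolding \<delta>_def using d d' K by simp
  have "dist ((f (c + s *\<^sub>R u + s *\<^sub>R v) - f (c + s *\<^sub>R u) - f (c + s *\<^sub>R v) + f c) / s\<^sup>2) (h v \<bullet> u) < e"
    if s: "0 < s" "s < \<delta>" for s
  proof -
    have sK: "s * K < min d d'" using s K unfolding \<delta>_def by (simp add: pos_less_divide_eq)
    have bd: "norm (\<theta> *\<^sub>R u + \<sigma> *\<^sub>R v) \<le> s * (norm u + norm v)" if "0 \<le> \<theta>" "\<theta> \<le> s" "0 \<le> \<sigma>" "\<sigma> \<le> s" for \<theta> \<sigma>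
    proof -
      have "norm (\<theta> *\<^sub>R u + \<sigma> *\<^sub>R v) \<le> \<theta> * norm u + \<sigma> * norm v"
        using norm_triangle_ineq[of "\<theta> *\<^sub>R u" "\<sigma> *\<^sub>R v"] that by simp
      also have "\<dots> \<le> s * norm u + s * norm v"
        using that by (intro add_mono mult_right_mono) auto
      finally show ?thesis by (simp add: algebra_simps)
    qed
    have sK2: "s * (norm u + norm v) < min d d'"
    proof -
      have "s * (norm u + norm v) \<le> s * K" unfolding K_def using s by (intro mult_left_mono) auto
      then show ?thesis using sK by linarith
    qed
    have inU: "c + \<theta> *\<^sub>R u + \<sigma> *\<^sub>R v \<in> U" if "0 \<le> \<theta>" "\<theta> \<le> s" "0 \<le> \<sigma>" "\<sigma> \<le> s" for \<theta> \<sigma>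
    proof -
      have "dist c (c + (\<theta> *\<^sub>R u + \<sigma> *\<^sub>R v)) < d'"
        using le_less_trans[OF bd[OF that] sK2] by (simp add: dist_norm norm_minus_commute add.commute)
      then show ?thesis using d' by (auto simp: add.assoc)
    qed
    \<comment> \<open>The second difference is an increment of \<open>\<psi>\<close>. A single mean
      value step along \<open>u\<close> leaves a difference of two gradients near \<open>c\<close>,
      which differentiability of \<open>g\<close> at the one point \<open>c\<close>
      controls.\<close>
    define \<psi> where "\<psi> = (\<lambda>t. f (c + t *\<^sub>R u + s *\<^sub>R v) - f (c + t *\<^sub>R u))"
    have D: "(\<psi> has_real_derivative ((g (c + t *\<^sub>R u + s *\<^sub>R v) - g (c + t *\<^sub>R u)) \<bullet> u)) (at t)"
      if "0 \<le> t" "t \<le> s" for t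
    proof -
      have line: "((\<lambda>t. w + t *\<^sub>R u + w') has_derivative (\<lambda>k. k *\<^sub>R u)) (at t)" for w w'
        by (auto intro!: derivative_eq_intros)
      have 1: "((\<lambda>t. f (c + t *\<^sub>R u + s *\<^sub>R v)) has_derivative (\<lambda>k. g (c + t *\<^sub>R u + s *\<^sub>R v) \<bullet> (k *\<^sub>R u))) (at t)"
        by (rule has_derivative_compose[OF line f]) (rule inU, use that s in auto)
      have 2: "((\<lambda>t. f (c + t *\<^sub>R u)) has_derivative (\<lambda>k. g (c + t *\<^sub>R u) \<bullet> (k *\<^sub>R u))) (at t)"
        using has_derivative_compose[OF line[of c 0] f] inU[of t 0] that s by auto
      show ?thesis unfolding has_field_derivative_def \<psi>_def
        by (rule has_derivative_eq_rhs[OF has_derivative_diff[OF 1 2]]) (auto simp: algebra_simps inner_simps)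
    qed
    obtain \<theta> where \<theta>: "0 < \<theta>" "\<theta> < s" and mv: "\<psi> s - \<psi> 0 = (s - 0) * ((g (c + \<theta> *\<^sub>R u + s *\<^sub>R v) - g (c + \<theta> *\<^sub>R u)) \<bullet> u)"
      using MVT2[OF s(1), of \<psi> "\<lambda>t. (g (c + t *\<^sub>R u + s *\<^sub>R v) - g (c + t *\<^sub>R u)) \<bullet> u"] D by auto
    define \<rho> where "\<rho> = (\<lambda>y. g y - g c - h (y - c))"
    have \<rho>: "norm (\<rho> (c + \<theta> *\<^sub>R u + \<sigma> *\<^sub>R v)) \<le> \<epsilon> * (s * (norm u + norm v))" if "0 \<le> \<sigma>" "\<sigma> \<le> s" for \<sigma>
    proof -
      have "norm ((c + \<theta> *\<^sub>R u + \<sigma> *\<^sub>R v) - c) \<le> s * (norm u + norm v)"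
        using bd[of \<theta> \<sigma>] \<theta> that by (simp add: algebra_simps)
      then show ?thesis unfolding \<rho>_def using r[of "c + \<theta> *\<^sub>R u + \<sigma> *\<^sub>R v"] sK2 \<epsilon>
        by (smt (verit, best) mult_left_mono min_less_iff_conj)
    qed
    have bnd2: "norm (\<rho> (c + \<theta> *\<^sub>R u)) \<le> \<epsilon> * (s * norm u)"
    proof -
      have n: "norm ((c + \<theta> *\<^sub>R u) - c) \<le> s * norm u"
        using \<theta> by (simp add: mult_right_mono)
      also have "\<dots> < d" using sK2 s by (smt (verit) min_less_iff_conj mult_left_mono norm_ge_zero)
      finally show ?thesis unfolding \<rho>_def using r[of "c + \<theta> *\<^sub>R u"] n \<epsilon>
        by (smt (verit, best) mult_left_mono)
    qed
    have diffg: "g (c + \<theta> *\<^sub>R u + s *\<^sub>R v) - g (c + \<theta> *\<^sub>R u) = s *\<^sub>R h v + (\<rho> (c + \<theta> *\<^sub>R u + s *\<^sub>R v) - \<rho> (c + \<theta> *\<^sub>R u))"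
      unfolding \<rho>_def by (simp add: h.add h.scaleR h.diff)
    have eq: "(f (c + s *\<^sub>R u + s *\<^sub>R v) - f (c + s *\<^sub>R u) - f (c + s *\<^sub>R v) + f c) / s\<^sup>2 - h v \<bullet> u
       = ((\<rho> (c + \<theta> *\<^sub>R u + s *\<^sub>R v) - \<rho> (c + \<theta> *\<^sub>R u)) \<bullet> u) / s"
    proof -
      have "f (c + s *\<^sub>R u + s *\<^sub>R v) - f (c + s *\<^sub>R u) - f (c + s *\<^sub>R v) + f c = \<psi> s - \<psi> 0"
        unfolding \<psi>_def by simp
      also have "\<dots> = s * ((s *\<^sub>R h v + (\<rho> (c + \<theta> *\<^sub>R u + s *\<^sub>R v) - \<rho> (c + \<theta> *\<^sub>R u))) \<bullet> u)"
        using mv diffg by simp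
      finally have "f (c + s *\<^sub>R u + s *\<^sub>R v) - f (c + s *\<^sub>R u) - f (c + s *\<^sub>R v) + f c
        = s\<^sup>2 * (h v \<bullet> u) + s * ((\<rho> (c + \<theta> *\<^sub>R u + s *\<^sub>R v) - \<rho> (c + \<theta> *\<^sub>R u)) \<bullet> u)"
        by (simp only: inner_add_left inner_scaleR_left distrib_left power2_eq_square mult.assoc)
      then show ?thesis using s by (simp add: add_divide_distrib power2_eq_square)
    qed
    have "\<bar>((\<rho> (c + \<theta> *\<^sub>R u + s *\<^sub>R v) - \<rho> (c + \<theta> *\<^sub>R u)) \<bullet> u)\<bar>
       \<le> norm (\<rho> (c + \<theta> *\<^sub>R u + s *\<^sub>R v) - \<rho> (c + \<theta> *\<^sub>R u)) * norm u"
      by (rule Cauchy_Schwarz_ineq2)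
    also have "\<dots> \<le> (\<epsilon> * s * K) * norm u"
    proof (rule mult_right_mono)
      have "norm (\<rho> (c + \<theta> *\<^sub>R u + s *\<^sub>R v) - \<rho> (c + \<theta> *\<^sub>R u)) \<le> \<epsilon> * (s * (norm u + norm v)) + \<epsilon> * (s * norm u)"
        using norm_triangle_ineq4[of "\<rho> (c + \<theta> *\<^sub>R u + s *\<^sub>R v)" "\<rho> (c + \<theta> *\<^sub>R u)"] \<rho>[of s] bnd2 s by linarith
      also have "\<dots> \<le> \<epsilon> * s * K" unfolding K_def using \<epsilon> s by (simp add: algebra_simps)
      finally show "norm (\<rho> (c + \<theta> *\<^sub>R u + s *\<^sub>R v) - \<rho> (c + \<theta> *\<^sub>R u)) \<le> \<epsilon> * s * K" .
    qed simp
    also have "\<dots> \<le> (\<epsilon> * s * K) * (norm u + 1)" using \<epsilon> s K by (intro mult_left_mono) auto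
    also have "\<dots> = s * (e / 2)"
    proof -
      have "norm u + 1 \<noteq> 0" by (smt (verit) norm_ge_zero)
      then have "\<epsilon> * K * (norm u + 1) = e / 2" unfolding \<epsilon>_def using K by (simp del: distrib_left_numeral)
      then show ?thesis by (metis mult.assoc mult.commute)
    qed
    finally have "\<bar>((\<rho> (c + \<theta> *\<^sub>R u + s *\<^sub>R v) - \<rho> (c + \<theta> *\<^sub>R u)) \<bullet> u)\<bar> \<le> s * (e/2)" .
    then have "\<bar>((\<rho> (c + \<theta> *\<^sub>R u + s *\<^sub>R v) - \<rho> (c + \<theta> *\<^sub>R u)) \<bullet> u) / s\<bar> \<le> e/2"
      using s by (simp add: field_simps abs_mult)
    then show ?thesis unfolding dist_real_def eq using e by linarith
  qed
  then show "\<forall>\<^sub>F s in at_right 0. dist ((f (c + s *\<^sub>R u + s *\<^sub>R v) - f (c + s *\<^sub>R u) - f (c + s *\<^sub>R v) + f c) / s\<^sup>2) (h v \<bullet> u) < e"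
    using \<delta> unfolding eventually_at_right_field by (intro exI[of _ \<delta>]) auto
qed

text \<open>The second difference is symmetric in \<open>u\<close> and \<open>v\<close>, so its
  limits in the two orders coincide. This is Schwarz's theorem from differentiability of the
  gradient at a single point.\<close>

lemma gradient_derivative_symmetric:
  fixes f :: "'a::real_inner \<Rightarrow> real"
  assumes U: "open U" "c \<in> U"
    and f: "\<And>x. x \<in> U \<Longrightarrow> (f has_derivative (\<lambda>v. g x \<bullet> v)) (at x)"
    and g: "(g has_derivative h) (at c)"
  shows "h u \<bullet> v = u \<bullet> h v"
proof -
  have "((\<lambda>s. (f (c + s *\<^sub>R u + s *\<^sub>R v) - f (c + s *\<^sub>R u) - f (c + s *\<^sub>R v) + f c) / s\<^sup>2) \<longlongrightarrow> h u \<bullet> v) (at_right 0)"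
    using second_difference_tendsto[OF U f g, of v u] by (simp add: algebra_simps)
  with second_difference_tendsto[OF U f g, of u v] have "h u \<bullet> v = h v \<bullet> u"
    using tendsto_unique trivial_limit_at_right_real by blast
  then show ?thesis by (simp add: inner_commute)
qed

text \<open>Such \<open>v\<close> form the Bouligand contingent cone of \<open>M\<close> at
  \<open>p\<close>. The scales \<open>s n\<close> need not be the distances
  \<open>norm (y n - p)\<close>, which admits \<open>v = 0\<close> and
  \<open>y n = p\<close>.\<close>

definition tangent_sequence :: "'a::real_normed_vector set \<Rightarrow> 'a \<Rightarrow> 'a \<Rightarrow> (nat \<Rightarrow> 'a) \<Rightarrow> (nat \<Rightarrow> real) \<Rightarrow> bool" where
  "tangent_sequence M p v y s \<longleftrightarrow> (\<forall>n. y n \<in> M \<and> 0 < s n) \<and> s \<longlonglongrightarrow> 0 \<and>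
     (\<lambda>n. (y n - p) /\<^sub>R s n) \<longlonglongrightarrow> v"

lemma tangent_sequence_tendsto:
  assumes "tangent_sequence M p v y s"
  shows "y \<longlonglongrightarrow> p"
proof -
  have "(\<lambda>n. p + s n *\<^sub>R ((y n - p) /\<^sub>R s n)) \<longlonglongrightarrow> p + 0 *\<^sub>R v"
    using assms unfolding tangent_sequence_def by (intro tendsto_intros) auto
  moreover have "(\<lambda>n. p + s n *\<^sub>R ((y n - p) /\<^sub>R s n)) = y"
  proof
    fix n have "s n \<noteq> 0" using assms unfolding tangent_sequence_def by (metis less_irrefl)
    then show "p + s n *\<^sub>R ((y n - p) /\<^sub>R s n) = y n" by simp
  qed
  ultimately show ?thesis by simp
qed

lemma has_derivative_tangent_sequence:
  assumes ts: "tangent_sequence M p v y s"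
    and f: "(f has_derivative f') (at p within M)"
  shows "(\<lambda>n. (f (y n) - f p) /\<^sub>R s n) \<longlonglongrightarrow> f' v"
proof -
  interpret f': bounded_linear f' using f by (rule has_derivative_bounded_linear)
  have pos: "s n > 0" and yM: "y n \<in> M" for n using ts unfolding tangent_sequence_def by auto
  \<comment> \<open>At \<open>z = p\<close> the value is \<open>0\<close>, since
    \<open>inverse 0 = 0\<close>; hence \<open>q\<close> is continuous at \<open>p\<close> within
    \<open>M\<close> and can be evaluated along \<open>y\<close> even where
    \<open>y n = p\<close>.\<close>
  define q where "q = (\<lambda>z. (f z - f p - f' (z - p)) /\<^sub>R norm (z - p))"
  have "(q \<longlongrightarrow> 0) (at p within M)"
    using f unfolding has_derivative_at_within q_def by auto
  then have "continuous (at p within M) q"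
    by (simp add: continuous_within q_def)
  then have "(\<lambda>n. q (y n)) \<longlonglongrightarrow> q p"
    using tangent_sequence_tendsto[OF ts] yM unfolding continuous_within_sequentially by (auto simp: o_def)
  then have q: "(\<lambda>n. q (y n)) \<longlonglongrightarrow> 0" by (simp add: q_def)
  have lim: "(\<lambda>n. (y n - p) /\<^sub>R s n) \<longlonglongrightarrow> v" using ts unfolding tangent_sequence_def by auto
  have "(\<lambda>n. f' ((y n - p) /\<^sub>R s n) + norm ((y n - p) /\<^sub>R s n) *\<^sub>R q (y n)) \<longlonglongrightarrow> f' v + norm v *\<^sub>R 0"
    by (intro tendsto_intros f'.tendsto lim q)
  moreover have "f' ((y n - p) /\<^sub>R s n) + norm ((y n - p) /\<^sub>R s n) *\<^sub>R q (y n) = (f (y n) - f p) /\<^sub>R s n" for n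
  proof (cases "y n = p")
    case True then show ?thesis by (simp add: f'.zero)
  next
    case False
    then have "norm ((y n - p) /\<^sub>R s n) *\<^sub>R q (y n) = (f (y n) - f p - f' (y n - p)) /\<^sub>R s n"
      using pos[of n] unfolding q_def by simp
    then show ?thesis unfolding f'.scaleR by (simp only: scaleR_diff_right) (simp add: algebra_simps)
  qed
  ultimately show ?thesis by simp
qed

text \<open>The intermediate value theorem is applied on a short segment through
  \<open>p + s *\<^sub>R v\<close> parallel to the gradient. Since \<open>g \<bullet> v = 0\<close>,
  \<open>f\<close> is \<open>o(s)\<close> at its midpoint, while moving by
  \<open>\<epsilon> * s\<close> along the gradient changes \<open>f\<close> by about
  \<open>\<epsilon> * s * norm g\<close>; so \<open>f\<close> has a zero on the segment.\<close>

lemma level_set_tangent_sequence: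
  fixes f :: "'a::euclidean_space \<Rightarrow> real"
  assumes U: "open U" "p \<in> U" and cont: "continuous_on U f"
    and f: "(f has_derivative (\<lambda>v. g \<bullet> v)) (at p)" and g: "g \<noteq> 0" and fp: "f p = 0"
    and v: "g \<bullet> v = 0"
  obtains y s where "tangent_sequence {x\<in>U. f x = 0} p v y s"
proof -
  have *: "\<exists>s y. 0 < s \<and> s < \<epsilon> \<and> y \<in> U \<and> f y = 0 \<and> norm (y - p - s *\<^sub>R v) \<le> \<epsilon> * s" if \<epsilon>: "\<epsilon> > 0" for \<epsilon>
  proof -
    define K where "K = norm v + \<epsilon>"
    have K: "K > 0" unfolding K_def using \<epsilon> by (simp add: add_nonneg_pos)
    \<comment> \<open>With this tolerance the linearization error on the segment, at most
      \<open>\<eta> * (s * K)\<close>, is half of the change \<open>\<epsilon> * s * norm g\<close>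
      attained at the ends.\<close>
    define \<eta> where "\<eta> = \<epsilon> * norm g / (2 * K)"
    have \<eta>: "\<eta> > 0" unfolding \<eta>_def using \<epsilon> g K by simp
    obtain d where d: "d > 0" and r: "\<And>y. norm (y - p) < d \<Longrightarrow> norm (f y - f p - g \<bullet> (y - p)) \<le> \<eta> * norm (y - p)"
      using f \<eta> unfolding has_derivative_at_alt by blast
    obtain d' where d': "d' > 0" "ball p d' \<subseteq> U" using U open_contains_ball by blast
    define s where "s = min \<epsilon> (min d d' / K) / 2"
    have s0: "0 < s" unfolding s_def using \<epsilon> d d' K by simp
    have s\<epsilon>: "s < \<epsilon>" unfolding s_def using \<epsilon> d d' K by (auto simp: min_def)
    have "s < min d d' / K" unfolding s_def using \<epsilon> d d' K
      by (smt (verit, best) divide_pos_pos field_sum_of_halves min_def)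
    then have sK: "s * K < min d d'" using K by (simp add: pos_less_divide_eq)
    define e where "e = g /\<^sub>R norm g"
    have e: "norm e = 1" "g \<bullet> e = norm g" unfolding e_def using g
      by (simp_all add: dot_square_norm power2_eq_square)
    define \<gamma> where "\<gamma> = (\<lambda>t. p + s *\<^sub>R v + (t * s) *\<^sub>R e)"
    have nb: "norm (\<gamma> t - p) \<le> s * K" if "\<bar>t\<bar> \<le> \<epsilon>" for t
    proof -
      have "norm (\<gamma> t - p) \<le> norm (s *\<^sub>R v) + norm ((t * s) *\<^sub>R e)"
        unfolding \<gamma>_def by (metis add.assoc add_diff_cancel_left' norm_triangle_ineq)
      also have "\<dots> = s * norm v + \<bar>t\<bar> * s" using s0 e by (simp add: abs_mult)
      also have "\<dots> \<le> s * K" unfolding K_def using s0 that by (simp add: algebra_simps mult_right_mono)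
      finally show ?thesis .
    qed
    have inU: "\<gamma> t \<in> U" if "\<bar>t\<bar> \<le> \<epsilon>" for t
    proof -
      have "\<gamma> t \<in> ball p d'" using nb[OF that] sK by (simp add: dist_norm norm_minus_commute)
      then show ?thesis using d' by auto
    qed
    have val: "\<bar>f (\<gamma> t) - t * s * norm g\<bar> \<le> \<epsilon> * s * norm g / 2" if "\<bar>t\<bar> \<le> \<epsilon>" for t
    proof -
      have "g \<bullet> (\<gamma> t - p) = t * s * norm g" unfolding \<gamma>_def using v e by (simp add: inner_simps)
      moreover have "norm (f (\<gamma> t) - f p - g \<bullet> (\<gamma> t - p)) \<le> \<eta> * (s * K)"
        using r[of "\<gamma> t"] nb[OF that] sK \<eta> by (smt (verit, best) mult_left_mono min_less_iff_conj)
      moreover have "\<eta> * (s * K) = \<epsilon> * s * norm g / 2" unfolding \<eta>_def using K by simp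
      ultimately show ?thesis using fp by simp
    qed
    have pos: "\<epsilon> * s * norm g > 0" using \<epsilon> s0 g by simp
    have lo: "f (\<gamma> (-\<epsilon>)) \<le> 0" using val[of "-\<epsilon>"] pos \<epsilon> unfolding abs_le_iff minus_mult_left[symmetric] by linarith
    have hi: "0 \<le> f (\<gamma> \<epsilon>)" using val[of "\<epsilon>"] pos \<epsilon> unfolding abs_le_iff by linarith
    have "continuous_on {-\<epsilon>..\<epsilon>} (\<lambda>t. f (\<gamma> t))"
    proof (rule continuous_on_compose2[OF cont])
      show "continuous_on {-\<epsilon>..\<epsilon>} \<gamma>" unfolding \<gamma>_def by (intro continuous_intros)
      show "\<gamma> ` {-\<epsilon>..\<epsilon>} \<subseteq> U" using inU by auto
    qed
    then obtain t where t: "-\<epsilon> \<le> t" "t \<le> \<epsilon>" "f (\<gamma> t) = 0"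
      using IVT'[of "\<lambda>t. f (\<gamma> t)" "-\<epsilon>" 0 "\<epsilon>"] lo hi \<epsilon> by auto
    have "norm (\<gamma> t - p - s *\<^sub>R v) \<le> \<epsilon> * s"
      unfolding \<gamma>_def using e s0 t by (simp add: abs_mult mult_right_mono)
    then show ?thesis using s0 s\<epsilon> inU[of t] t by (intro exI[of _ s] exI[of _ "\<gamma> t"]) auto
  qed
  have "\<forall>n. \<exists>s y. 0 < s \<and> s < inverse (real (Suc n)) \<and> y \<in> U \<and> f y = 0 \<and> norm (y - p - s *\<^sub>R v) \<le> inverse (real (Suc n)) * s"
    using * by simp
  then obtain s y where sy: "\<And>n. 0 < s n" "\<And>n. s n < inverse (real (Suc n))" "\<And>n. y n \<in> U \<and> f (y n) = 0"
    "\<And>n. norm (y n - p - s n *\<^sub>R v) \<le> inverse (real (Suc n)) * s n" by metis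
  have s: "s \<longlonglongrightarrow> 0"
    by (rule tendsto_sandwich[OF _ _ tendsto_const LIMSEQ_inverse_real_of_nat])
       (use sy(1,2) in \<open>auto intro!: always_eventually less_imp_le\<close>)
  have "(\<lambda>n. (y n - p) /\<^sub>R s n - v) \<longlonglongrightarrow> 0"
  proof (rule Lim_null_comparison[OF _ LIMSEQ_inverse_real_of_nat], intro always_eventually allI)
    fix n
    have "(y n - p) /\<^sub>R s n - v = (y n - p - s n *\<^sub>R v) /\<^sub>R s n"
      using sy(1)[of n] by (simp add: algebra_simps)
    then have "norm ((y n - p) /\<^sub>R s n - v) = norm (y n - p - s n *\<^sub>R v) / s n"
      using sy(1)[of n] by (simp only: norm_scaleR) (simp add: divide_inverse)
    then show "norm ((y n - p) /\<^sub>R s n - v) \<le> inverse (real (Suc n))"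
      using sy(4)[of n] sy(1)[of n] by (simp add: pos_divide_le_eq)
  qed
  then have "(\<lambda>n. (y n - p) /\<^sub>R s n) \<longlonglongrightarrow> v" by (rule LIM_zero_cancel)
  with s sy have "tangent_sequence {x\<in>U. f x = 0} p v y s"
    unfolding tangent_sequence_def by auto
  then show thesis by (rule that)
qed

section \<open>The unit normal of a convex core\<close>

text \<open>A step of length \<open>e\<close> from \<open>y0\<close> along \<open>u\<close> stays in
  \<open>C\<close> and raises the inner product by \<open>e * norm u\<close>. The strict sign serves
  to tell outward from inward normals.\<close>

lemma supporting_normal_interior_neg:
  fixes C :: "'a::real_inner set"
  assumes "y0 \<in> interior C" "u \<noteq> 0" "\<And>y. y \<in> C \<Longrightarrow> u \<bullet> (y - c) \<le> 0"
  shows "u \<bullet> (y0 - c) < 0"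
proof -
  obtain e where e: "e > 0" "cball y0 e \<subseteq> C" using assms(1) mem_interior_cball by blast
  have "y0 + (e / norm u) *\<^sub>R u \<in> cball y0 e" using e assms(2) by (simp add: dist_norm)
  then have "u \<bullet> (y0 + (e / norm u) *\<^sub>R u - c) \<le> 0" using e assms(3) by auto
  moreover have "u \<bullet> (y0 + (e / norm u) *\<^sub>R u - c) = u \<bullet> (y0 - c) + e * norm u"
    using assms(2) by (simp add: inner_diff_right inner_add_right dot_square_norm power2_eq_square)
  moreover have "e * norm u > 0" using e assms(2) by simp
  ultimately show ?thesis by linarith
qed

lemma supporting_normal_exists:
  fixes C :: "'a::euclidean_space set"
  assumes "convex C" "interior C \<noteq> {}" "c \<notin> interior C"
  obtains u where "norm u = 1" "\<And>y. y \<in> C \<Longrightarrow> u \<bullet> (y - c) \<le> 0"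
proof -
  obtain a b where a: "a \<noteq> 0" "\<forall>x\<in>interior C. a \<bullet> x \<le> b" "\<forall>x\<in>{c}. a \<bullet> x \<ge> b"
    using separating_hyperplane_sets[of "interior C" "{c}"] assms convex_interior by auto
  have "closure (interior C) \<subseteq> {x. a \<bullet> x \<le> b}"
    using a by (intro closure_minimal closed_halfspace_le) auto
  then have "C \<subseteq> {x. a \<bullet> x \<le> b}"
    using convex_closure_interior[OF assms(1,2)] closure_subset by blast
  then have le: "a \<bullet> (y - c) \<le> 0" if "y \<in> C" for y
    using that a(3) by (force simp: inner_diff_right)
  show thesis
  proof (rule that)
    show "norm (a /\<^sub>R norm a) = 1" using a by simp
    show "(a /\<^sub>R norm a) \<bullet> (y - c) \<le> 0" if "y \<in> C" for y
      using le[OF that] a(1) by (simp add: mult_nonneg_nonpos)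
  qed
qed

lemma boundary_chart:
  assumes "convex_core C" "c \<in> frontier C"
  obtains U g f h where "open U" "c \<in> U" "g c \<noteq> 0" "frontier C \<inter> U = {x\<in>U. f x = 0}"
    "\<forall>x\<in>U. (f has_derivative (\<lambda>v. g x \<bullet> v)) (at x)"
    "\<forall>x\<in>U. (g has_derivative blinfun_apply (h x)) (at x)" "continuous_on U h"
proof -
  from assms obtain U f g where *: "open U" "c \<in> U" "C2_with_gradient U f g" "g c \<noteq> 0"
    "frontier C \<inter> U = {x\<in>U. f x = 0}"
    unfolding convex_core_def C2_hypersurface_def by blast
  from *(3) obtain h where "\<forall>x\<in>U. (g has_derivative blinfun_apply (h x)) (at x)" "continuous_on U h"
    unfolding C2_with_gradient_def by blast
  with * show thesis using that[of U g f h] unfolding C2_with_gradient_def by blast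
qed

lemma boundary_chart_tangent_sequence:
  fixes C :: "'a::euclidean_space set"
  assumes "open U" "c \<in> U" "g c \<noteq> 0" "frontier C \<inter> U = {x\<in>U. f x = 0}"
    "\<forall>x\<in>U. (f has_derivative (\<lambda>v. g x \<bullet> v)) (at x)" "c \<in> frontier C" "g c \<bullet> v = 0"
  shows "\<exists>y s. tangent_sequence (frontier C) c v y s"
proof -
  have "continuous_on U f"
    by (intro continuous_at_imp_continuous_on ballI has_derivative_continuous[OF bspec[OF assms(5)]])
  moreover have "f c = 0" using assms by blast
  ultimately obtain y s where "tangent_sequence {x\<in>U. f x = 0} c v y s"
    using level_set_tangent_sequence[OF assms(1,2) _ bspec[OF assms(5) assms(2)] assms(3) _ assms(7)] by metis
  moreover have "{x\<in>U. f x = 0} \<subseteq> frontier C" using assms(4) by blast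
  ultimately show ?thesis unfolding tangent_sequence_def by blast
qed

text \<open>The support inequality passes to the limit along tangent sequences. Applied to
  \<open>v\<close> and \<open>-v\<close> it shows that \<open>u\<close> annihilates the orthogonal
  complement of \<open>g\<close>.\<close>

lemma supporting_normal_parallel:
  fixes g u :: "'a::real_inner"
  assumes "g \<noteq> 0" and ts: "\<And>v. g \<bullet> v = 0 \<Longrightarrow> \<exists>y s. tangent_sequence C c v y s"
    and supp: "\<And>y. y \<in> C \<Longrightarrow> u \<bullet> (y - c) \<le> 0"
  shows "u = ((u \<bullet> g) / (g \<bullet> g)) *\<^sub>R g"
proof -
  have le: "u \<bullet> v \<le> 0" if v: "g \<bullet> v = 0" for v
  proof -
    obtain y s where ys: "tangent_sequence C c v y s" using ts[OF v] by blast
    have "(\<lambda>n. u \<bullet> ((y n - c) /\<^sub>R s n)) \<longlonglongrightarrow> u \<bullet> v"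
      using ys unfolding tangent_sequence_def by (intro tendsto_intros) auto
    moreover have "u \<bullet> ((y n - c) /\<^sub>R s n) \<le> 0" for n
      using supp[of "y n"] ys unfolding tangent_sequence_def by (simp add: mult_nonneg_nonpos less_imp_le)
    ultimately show ?thesis by (intro LIMSEQ_le_const2) auto
  qed
  have z: "u \<bullet> v = 0" if "g \<bullet> v = 0" for v using le[of v] le[of "-v"] that by simp
  define w where "w = u - ((u \<bullet> g) / (g \<bullet> g)) *\<^sub>R g"
  have gw: "g \<bullet> w = 0" unfolding w_def using assms(1) by (simp add: inner_diff_right inner_commute)
  then have "w \<bullet> w = 0" using z[OF gw] unfolding w_def by (simp add: inner_diff_left inner_diff_right)
  then show ?thesis unfolding w_def by simp
qed

lemma closed_convex_core: "convex_core C \<Longrightarrow> closed C"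
  unfolding convex_core_def by (simp add: compact_imp_closed)

lemma frontier_convex_coreD:
  assumes "convex_core C" "c \<in> frontier C"
  shows "c \<in> C" "c \<notin> interior C"
  using assms closed_convex_core[OF assms(1)] unfolding frontier_def by auto

text \<open>Smoothness of the boundary leaves two candidates, the unit multiples of the chart
  gradient, and an interior point of \<open>C\<close> rules out that both are supporting. Thus the
  description in \<open>outward_normal\<close> denotes.\<close>

lemma supporting_normal_unique:
  assumes C: "convex_core C" "c \<in> frontier C"
    and u: "norm u = 1" "\<And>y. y \<in> C \<Longrightarrow> u \<bullet> (y - c) \<le> 0"
    and w: "norm w = 1" "\<And>y. y \<in> C \<Longrightarrow> w \<bullet> (y - c) \<le> 0"
  shows "u = w"
proof -
  obtain U f g h where chart: "open U" "c \<in> U" "g c \<noteq> 0" "frontier C \<inter> U = {x\<in>U. f x = 0}"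
    "\<forall>x\<in>U. (f has_derivative (\<lambda>v. g x \<bullet> v)) (at x)"
    and "\<forall>x\<in>U. (g has_derivative blinfun_apply (h x)) (at x)" "continuous_on U h"
    using boundary_chart[OF C] .
  have "frontier C \<subseteq> C" using frontier_convex_coreD(1)[OF C(1)] by auto
  then have ts: "\<exists>y s. tangent_sequence C c v y s" if "g c \<bullet> v = 0" for v
    using boundary_chart_tangent_sequence[OF chart C(2) that] unfolding tangent_sequence_def by blast
  obtain k where k: "u = k *\<^sub>R g c" using supporting_normal_parallel[OF chart(3) ts u(2)] by blast
  obtain l where l: "w = l *\<^sub>R g c" using supporting_normal_parallel[OF chart(3) ts w(2)] by blast
  have "\<bar>k\<bar> * norm (g c) = \<bar>l\<bar> * norm (g c)" using k l u w by simp
  then have "\<bar>k\<bar> = \<bar>l\<bar>" using chart(3) by simp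
  moreover have "k \<noteq> - l"
  proof
    assume "k = - l"
    then have uw: "u = - w" using k l by simp
    obtain y0 where y0: "y0 \<in> interior C" using C unfolding convex_core_def by blast
    have "u \<bullet> (y0 - c) < 0" by (rule supporting_normal_interior_neg[OF y0 _ u(2)]) (use u in auto)
    moreover have "w \<bullet> (y0 - c) < 0" by (rule supporting_normal_interior_neg[OF y0 _ w(2)]) (use w in auto)
    ultimately show False using uw by simp
  qed
  ultimately show ?thesis using k l by (auto simp: abs_eq_iff)
qed

lemma outward_normal:
  assumes C: "convex_core C" "c \<in> frontier C"
  shows norm_outward_normal: "norm (outward_normal C c) = 1"
    and outward_normal_supporting: "y \<in> C \<Longrightarrow> outward_normal C c \<bullet> (y - c) \<le> 0"
proof -
  obtain u where u: "norm u = 1" "\<And>y. y \<in> C \<Longrightarrow> u \<bullet> (y - c) \<le> 0"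
    using supporting_normal_exists[of C c] C frontier_convex_coreD[OF C] unfolding convex_core_def by metis
  have "norm (outward_normal C c) = 1 \<and> (\<forall>y\<in>C. outward_normal C c \<bullet> (y - c) \<le> 0)"
    unfolding outward_normal_def
    by (rule theI[of _ u]) (use u supporting_normal_unique[OF C] in blast)+
  then show "norm (outward_normal C c) = 1" "y \<in> C \<Longrightarrow> outward_normal C c \<bullet> (y - c) \<le> 0" by auto
qed

lemma outward_normal_eqI:
  assumes "convex_core C" "c \<in> frontier C" "norm u = 1" "\<And>y. y \<in> C \<Longrightarrow> u \<bullet> (y - c) \<le> 0"
  shows "outward_normal C c = u"
  using supporting_normal_unique[OF assms(1,2) outward_normal[OF assms(1,2)] assms(3,4)] by blast

lemma outward_normal_parallel:
  fixes C :: "'a::euclidean_space set"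
  assumes "convex_core C" "c \<in> frontier C" "open U" "c \<in> U" "g c \<noteq> 0" "frontier C \<inter> U = {x\<in>U. f x = 0}"
    "\<forall>x\<in>U. (f has_derivative (\<lambda>v. g x \<bullet> v)) (at x)"
  obtains k where "outward_normal C c = k *\<^sub>R g c" "k \<noteq> 0"
proof -
  have "frontier C \<subseteq> C" using frontier_convex_coreD(1)[OF assms(1)] by auto
  then have ts: "\<exists>y s. tangent_sequence C c v y s" if "g c \<bullet> v = 0" for v
    using boundary_chart_tangent_sequence[OF assms(3-7) assms(2) that] unfolding tangent_sequence_def by blast
  obtain k where k: "outward_normal C c = k *\<^sub>R g c"
    using supporting_normal_parallel[OF assms(5) ts outward_normal_supporting[OF assms(1,2)]] by blast
  moreover have "k \<noteq> 0" using norm_outward_normal[OF assms(1,2)] k by auto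
  ultimately show thesis using that by blast
qed

lemma tangent_sequence_exists:
  assumes "convex_core C" "c \<in> frontier C" "v \<in> tangent_space C c"
  obtains y s where "tangent_sequence (frontier C) c v y s"
proof -
  obtain U f g h where chart: "open U" "c \<in> U" "g c \<noteq> 0" "frontier C \<inter> U = {x\<in>U. f x = 0}"
    "\<forall>x\<in>U. (f has_derivative (\<lambda>v. g x \<bullet> v)) (at x)"
    and "\<forall>x\<in>U. (g has_derivative blinfun_apply (h x)) (at x)" "continuous_on U h"
    using boundary_chart[OF assms(1,2)] .
  obtain k where "outward_normal C c = k *\<^sub>R g c" "k \<noteq> 0"
    using outward_normal_parallel[OF assms(1,2) chart] .
  then have "g c \<bullet> v = 0" using assms(3) unfolding tangent_space_def by simp
  then show thesis using boundary_chart_tangent_sequence[OF chart assms(2)] that by blast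
qed

lemma has_derivative_frontier_unique:
  assumes "convex_core C" "c \<in> frontier C" "v \<in> tangent_space C c"
    and "(f has_derivative f') (at c within frontier C)" "(f has_derivative f'') (at c within frontier C)"
  shows "f' v = f'' v"
proof -
  obtain y s where ts: "tangent_sequence (frontier C) c v y s"
    using tangent_sequence_exists[OF assms(1-3)] .
  show ?thesis
    using has_derivative_tangent_sequence[OF ts assms(4)] has_derivative_tangent_sequence[OF ts assms(5)]
    by (rule LIMSEQ_unique)
qed

lemma frechet_derivative_frontier:
  assumes "convex_core C" "c \<in> frontier C" "v \<in> tangent_space C c"
    and "(f has_derivative f') (at c within frontier C)"
  shows "frechet_derivative f (at c within frontier C) v = f' v"
proof (rule has_derivative_frontier_unique[OF assms(1-3) _ assms(4)])
  show "(f has_derivative frechet_derivative f (at c within frontier C)) (at c within frontier C)"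
    using assms(4) unfolding frechet_derivative_works[symmetric] by (auto simp: differentiable_def)
qed

text \<open>The defining function \<open>f\<close> vanishes on the surface, so there
  \<open>\<nu> \<bullet> y\<close> may be replaced by \<open>k * (g c \<bullet> y - f y)\<close>,
  whose ambient derivative at \<open>c\<close> is zero. Geometrically, the surface leaves its
  tangent plane at \<open>c\<close> by \<open>o(y - c)\<close>.\<close>

lemma outward_normal_component_has_derivative_zero:
  assumes "convex_core C" "c \<in> frontier C"
  shows "((\<lambda>y. outward_normal C c \<bullet> y) has_derivative (\<lambda>_. 0)) (at c within frontier C)"
proof -
  obtain U f g h where chart: "open U" "c \<in> U" "g c \<noteq> 0" "frontier C \<inter> U = {x\<in>U. f x = 0}"
    "\<forall>x\<in>U. (f has_derivative (\<lambda>v. g x \<bullet> v)) (at x)"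
    and "\<forall>x\<in>U. (g has_derivative blinfun_apply (h x)) (at x)" "continuous_on U h"
    using boundary_chart[OF assms(1,2)] .
  obtain k where k: "outward_normal C c = k *\<^sub>R g c" "k \<noteq> 0"
    using outward_normal_parallel[OF assms(1,2) chart] .
  have "(f has_derivative (\<lambda>v. g c \<bullet> v)) (at c within frontier C)"
    by (rule has_derivative_at_withinI[OF bspec[OF chart(5,2)]])
  then have D: "((\<lambda>y. k * (g c \<bullet> y - f y)) has_derivative (\<lambda>_. 0)) (at c within frontier C)"
    by (auto intro!: derivative_eq_intros)
  have f0: "f y = 0" if "y \<in> U" "y \<in> frontier C" for y using that chart(4) by blast
  obtain d where d: "d > 0" "ball c d \<subseteq> U" using chart(1,2) open_contains_ball by blast
  show ?thesis
  proof (rule has_derivative_transform_within[OF D d(1) assms(2)])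
    fix y assume y: "y \<in> frontier C" "dist y c < d"
    then have "y \<in> U" using d(2) by (auto simp: dist_commute)
    then show "k * (g c \<bullet> y - f y) = outward_normal C c \<bullet> y" using f0 y(1) by (simp add: k(1))
  qed
qed

text \<open>The extension is the normalized gradient of a defining function. Its derivative is
  symmetric on tangent vectors because the Hessian of \<open>f\<close> is: the term that
  differentiates the normalizing factor is a multiple of \<open>g x\<close> and vanishes against
  them.\<close>

lemma local_unit_normal:
  assumes C: "convex_core C" "c \<in> frontier C"
  obtains U N N' where "open U" "c \<in> U"
    "\<forall>x\<in>U. (N has_derivative blinfun_apply (N' x)) (at x)"
    "continuous_on U N'" "\<forall>x\<in>U. norm (N x) = 1"
    "\<forall>x\<in>frontier C \<inter> U. outward_normal C x = N x"
    "\<forall>x\<in>frontier C \<inter> U. \<forall>u\<in>tangent_space C x. \<forall>v\<in>tangent_space C x. N' x u \<bullet> v = u \<bullet> N' x v"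
proof -
  obtain U f g h where chart: "open U" "c \<in> U" "g c \<noteq> 0" "frontier C \<inter> U = {x\<in>U. f x = 0}"
    "\<forall>x\<in>U. (f has_derivative (\<lambda>v. g x \<bullet> v)) (at x)"
    and g: "\<forall>x\<in>U. (g has_derivative blinfun_apply (h x)) (at x)" and h: "continuous_on U h"
    using boundary_chart[OF C] .
  have contg: "continuous_on U g"
    by (intro continuous_at_imp_continuous_on ballI has_derivative_continuous[OF bspec[OF g]])
  obtain y0 where y0: "y0 \<in> interior C" using C unfolding convex_core_def by blast
  have neg: "outward_normal C x \<bullet> (y0 - x) < 0" if "x \<in> frontier C" for x
    by (rule supporting_normal_interior_neg[OF y0 _ outward_normal_supporting])
       (use C that norm_outward_normal[of C x] in auto)
  obtain k where k: "outward_normal C c = k *\<^sub>R g c" "k \<noteq> 0"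
    using outward_normal_parallel[OF C chart] .
  define \<sigma> where "\<sigma> = sgn k"
  have \<sigma>: "\<bar>\<sigma>\<bar> = 1" "\<sigma> \<noteq> 0" using k unfolding \<sigma>_def by (auto simp: sgn_if)
  \<comment> \<open>The sign \<open>\<sigma>\<close> orients the gradient outward at
    \<open>c\<close>. On \<open>V\<close> the vector \<open>\<sigma> *\<^sub>R g x\<close> keeps a
    negative inner product with the direction to the interior point \<open>y0\<close>; this gives
    \<open>g x \<noteq> 0\<close> and the same orientation at all boundary points of
    \<open>V\<close>.\<close>
  define V where "V = U \<inter> (\<lambda>x. \<sigma> * (g x \<bullet> (y0 - x))) -` {..<0}"
  have "open V" unfolding V_def
    by (intro continuous_open_preimage continuous_intros contg chart)
  have "k * (g c \<bullet> (y0 - c)) < 0" using neg[OF C(2)] k by simp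
  then have "sgn k * (g c \<bullet> (y0 - c)) < 0" by (simp add: mult_less_0_iff)
  then have cV: "c \<in> V" unfolding V_def \<sigma>_def using chart(2) by simp
  have VU: "V \<subseteq> U" unfolding V_def by auto
  have gV: "g x \<noteq> 0" if "x \<in> V" for x using that unfolding V_def by auto
  define N where "N = (\<lambda>x. inverse (norm (g x)) *\<^sub>R (\<sigma> *\<^sub>R g x))"
  define D where "D = (\<lambda>x v. inverse (norm (g x)) *\<^sub>R (\<sigma> *\<^sub>R h x v)
     - (inverse (norm (g x)) * (h x v \<bullet> sgn (g x)) * inverse (norm (g x))) *\<^sub>R (\<sigma> *\<^sub>R g x))"
  have DN: "(N has_derivative D x) (at x)" if "x \<in> V" for x
  proof -
    have g1: "(g has_derivative blinfun_apply (h x)) (at x)" using g VU that by blast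
    have n: "((\<lambda>x. norm (g x)) has_derivative (\<lambda>v. h x v \<bullet> sgn (g x))) (at x)"
      by (rule has_derivative_compose[OF g1 has_derivative_norm[OF gV[OF that]]])
    have "((\<lambda>x. inverse (norm (g x))) has_derivative
       (\<lambda>v. - (inverse (norm (g x)) * (h x v \<bullet> sgn (g x)) * inverse (norm (g x))))) (at x)"
      by (rule Deriv.has_derivative_inverse[OF _ n]) (simp add: gV[OF that])
    from has_derivative_scaleR[OF this has_derivative_scaleR_right[OF g1, of \<sigma>]]
    show ?thesis unfolding N_def
      by (rule has_derivative_eq_rhs) (simp add: D_def fun_eq_iff)
  qed
  define N' where "N' = (\<lambda>x. Blinfun (D x))"
  have N'D: "blinfun_apply (N' x) = D x" if "x \<in> V" for x
    unfolding N'_def by (rule bounded_linear_Blinfun_apply) (rule has_derivative_bounded_linear[OF DN[OF that]])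
  have par: "outward_normal C x = N x" if x: "x \<in> frontier C \<inter> V" for x
  proof -
    have xU: "x \<in> U" "x \<in> frontier C" "x \<in> V" using x VU by auto
    obtain l where l: "outward_normal C x = l *\<^sub>R g x" "l \<noteq> 0"
      using outward_normal_parallel[OF C(1) xU(2) chart(1) xU(1) gV[OF xU(3)] chart(4,5)] .
    have "l * (g x \<bullet> (y0 - x)) < 0" using neg[OF xU(2)] l by simp
    moreover have "\<sigma> * (g x \<bullet> (y0 - x)) < 0" using xU unfolding V_def by auto
    ultimately have l\<sigma>: "l * \<sigma> > 0" by (auto simp: mult_less_0_iff zero_less_mult_iff)
    have "\<bar>l\<bar> * norm (g x) = 1" using norm_outward_normal[OF C(1) xU(2)] l by simp
    then have ab: "\<bar>l\<bar> = inverse (norm (g x))" by (simp add: inverse_unique mult.commute)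
    have "\<sigma> = 1 \<or> \<sigma> = -1" using \<sigma>(1) by linarith
    then have "l = \<sigma> * inverse (norm (g x))" unfolding ab[symmetric] using l\<sigma> by auto
    then show ?thesis unfolding N_def using l by (simp add: mult.commute)
  qed
  show thesis
  proof (rule that[OF \<open>open V\<close> cV])
    show "\<forall>x\<in>V. (N has_derivative blinfun_apply (N' x)) (at x)"
      using DN N'D by simp
    show "continuous_on V N'"
    proof (rule continuous_on_blinfun_componentwise)
      fix i :: 'a
      have "continuous_on V (\<lambda>x. D x i)" unfolding D_def sgn_div_norm
        using gV by (intro continuous_intros continuous_on_subset[OF contg VU] continuous_on_subset[OF h VU]) auto
      then show "continuous_on V (\<lambda>x. blinfun_apply (N' x) i)"
        by (rule continuous_on_eq) (simp add: N'D)
    qed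
    show "\<forall>x\<in>V. norm (N x) = 1" using gV \<sigma> unfolding N_def by (simp add: abs_mult)
    show "\<forall>x\<in>frontier C \<inter> V. outward_normal C x = N x" by (intro ballI par)
  next
    show "\<forall>x\<in>frontier C \<inter> V. \<forall>u\<in>tangent_space C x. \<forall>v\<in>tangent_space C x. N' x u \<bullet> v = u \<bullet> N' x v"
    proof (intro ballI)
      fix x u v assume x: "x \<in> frontier C \<inter> V" and uv: "u \<in> tangent_space C x" "v \<in> tangent_space C x"
      have xV: "x \<in> V" "x \<in> U" using x VU by auto
      have gt: "g x \<bullet> u = 0" "g x \<bullet> v = 0"
        using uv gV[OF xV(1)] \<sigma> unfolding tangent_space_def par[OF x] N_def by auto
      have "N' x w \<bullet> w' = inverse (norm (g x)) * \<sigma> * (h x w \<bullet> w')" if "g x \<bullet> w' = 0" for w w'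
        unfolding N'D[OF xV(1)] D_def using that by (simp add: inner_diff_left)
      from this[of v u] this[of u v] gt
      show "N' x u \<bullet> v = u \<bullet> N' x v"
        using gradient_derivative_symmetric[OF chart(1) xV(2) bspec[OF chart(5)] bspec[OF g xV(2)], of u v]
        by (simp only: inner_commute[of u])
    qed
  qed
qed

lemma unit_field_derivative_orthogonal:
  fixes N :: "'a::real_normed_vector \<Rightarrow> 'b::real_inner"
  assumes "open U" "x \<in> U" "(N has_derivative D) (at x)" "\<And>y. y \<in> U \<Longrightarrow> norm (N y) = 1"
  shows "N x \<bullet> D v = 0"
proof -
  have "((\<lambda>y. N y \<bullet> N y) has_derivative (\<lambda>v. N x \<bullet> D v + D v \<bullet> N x)) (at x)"
    using assms(3) by (auto intro!: derivative_eq_intros)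
  moreover have "((\<lambda>y. N y \<bullet> N y) has_derivative (\<lambda>v. 0)) (at x)"
    by (rule has_derivative_transform_within_open[OF _ assms(1,2), of "\<lambda>_. 1"])
       (use assms(4) in \<open>auto simp: dot_square_norm\<close>)
  ultimately have "(\<lambda>v. N x \<bullet> D v + D v \<bullet> N x) = (\<lambda>v. 0)" by (rule has_derivative_unique)
  from fun_cong[OF this, of v] show ?thesis by (simp add: inner_commute)
qed

text \<open>The support inequalities at two boundary points add up to monotonicity of the normal
  field, which survives division by the square of \<open>s n\<close> and the limit. With the sign
  convention for \<open>S\<close> it makes \<open>I - d S\<close> positive definite on the tangent
  space for every \<open>d \<ge> 0\<close>.\<close>

lemma outward_normal_derivative_nonneg:
  assumes C: "convex_core C" "c \<in> frontier C" and v: "v \<in> tangent_space C c"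
    and D: "(outward_normal C has_derivative D) (at c within frontier C)"
  shows "0 \<le> D v \<bullet> v"
proof -
  obtain y s where ts: "tangent_sequence (frontier C) c v y s"
    using tangent_sequence_exists[OF C v] .
  have "(\<lambda>n. ((outward_normal C (y n) - outward_normal C c) /\<^sub>R s n) \<bullet> ((y n - c) /\<^sub>R s n)) \<longlonglongrightarrow> D v \<bullet> v"
    using has_derivative_tangent_sequence[OF ts D] ts unfolding tangent_sequence_def
    by (intro tendsto_intros) auto
  moreover have "0 \<le> ((outward_normal C (y n) - outward_normal C c) /\<^sub>R s n) \<bullet> ((y n - c) /\<^sub>R s n)" for n
  proof -
    have y: "y n \<in> frontier C" "s n > 0" using ts unfolding tangent_sequence_def by auto
    have "outward_normal C (y n) \<bullet> (c - y n) \<le> 0" "outward_normal C c \<bullet> (y n - c) \<le> 0"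
      using outward_normal_supporting C y frontier_convex_coreD by blast+
    then have "0 \<le> (outward_normal C (y n) - outward_normal C c) \<bullet> (y n - c)"
      by (simp add: inner_diff_left inner_diff_right)
    then show ?thesis using y by simp
  qed
  ultimately show ?thesis by (intro LIMSEQ_le_const) auto
qed

text \<open>Otherwise a hyperplane separates the open inward ray from the interior. It passes
  through \<open>c\<close> and supports \<open>C\<close>, so its normal is a positive multiple of
  \<open>\<nu>\<close>; but then the ray lies strictly on the side of \<open>C\<close>.\<close>

lemma inward_ray_meets_interior:
  assumes C: "convex_core C" "c \<in> frontier C"
  obtains s1 where "s1 > 0" "\<And>s. 0 < s \<Longrightarrow> s \<le> s1 \<Longrightarrow> c - s *\<^sub>R outward_normal C c \<in> interior C"
proof -
  let ?\<nu> = "outward_normal C c"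
  have conv: "convex C" and ne: "interior C \<noteq> {}" using C unfolding convex_core_def by auto
  have cC: "c \<in> C" using frontier_convex_coreD(1)[OF C] .
  have "\<exists>s>0. c - s *\<^sub>R ?\<nu> \<in> interior C"
  proof (rule ccontr)
    assume no: "\<not> ?thesis"
    define R where "R = (\<lambda>s. c - s *\<^sub>R ?\<nu>) ` {0<..}"
    have "convex ((+) c ` ((\<lambda>s. s *\<^sub>R (- ?\<nu>)) ` {0<..}))"
      by (intro convex_translation convex_linear_image) (auto intro!: linearI simp: algebra_simps)
    then have "convex R" unfolding R_def image_image by simp
    moreover have "R \<noteq> {}" unfolding R_def by auto
    moreover have "interior C \<inter> R = {}" using no unfolding R_def by auto
    ultimately obtain a b where a: "a \<noteq> 0" "\<forall>x\<in>interior C. a \<bullet> x \<le> b" "\<forall>x\<in>R. a \<bullet> x \<ge> b"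
      using separating_hyperplane_sets[of "interior C" R] convex_interior[OF conv] ne by blast
    have "closure (interior C) \<subseteq> {x. a \<bullet> x \<le> b}"
      using a by (intro closure_minimal closed_halfspace_le) auto
    then have le: "a \<bullet> y \<le> b" if "y \<in> C" for y
      using that convex_closure_interior[OF conv ne] closure_subset by blast
    have ray: "b \<le> a \<bullet> c - s * (a \<bullet> ?\<nu>)" if "s > 0" for s
      using a(3) that unfolding R_def by (auto simp: inner_diff_right)
    have "((\<lambda>s. a \<bullet> c - s * (a \<bullet> ?\<nu>)) \<longlongrightarrow> a \<bullet> c - 0 * (a \<bullet> ?\<nu>)) (at_right 0)"
      by (intro tendsto_intros)
    then have "b \<le> a \<bullet> c - 0 * (a \<bullet> ?\<nu>)"
      by (rule tendsto_lowerbound) (auto simp: eventually_at_right_less ray intro: eventually_at_rightI[of 0 1])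
    then have ac: "a \<bullet> c = b" using le[OF cC] by simp
    have "?\<nu> = a /\<^sub>R norm a"
    proof (rule outward_normal_eqI[OF C])
      show "norm (a /\<^sub>R norm a) = 1" using a by simp
      show "(a /\<^sub>R norm a) \<bullet> (y - c) \<le> 0" if "y \<in> C" for y
        using le[OF that] ac a(1) by (simp add: inner_diff_right mult_nonneg_nonpos)
    qed
    then have "a \<bullet> ?\<nu> = norm a" using a(1) by (simp add: dot_square_norm power2_eq_square)
    then show False using ray[of 1] ac a(1) by simp
  qed
  then obtain s1 where s1: "s1 > 0" "c - s1 *\<^sub>R ?\<nu> \<in> interior C" by blast
  show thesis
  proof (rule that[OF s1(1)])
    fix s :: real assume s: "0 < s" "s \<le> s1"
    have "c - (s / s1) *\<^sub>R (c - (c - s1 *\<^sub>R ?\<nu>)) \<in> interior C"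
      by (rule mem_interior_convex_shrink[OF conv s1(2) cC]) (use s s1 in auto)
    then show "c - s *\<^sub>R ?\<nu> \<in> interior C" using s1(1) by simp
  qed
qed

section \<open>Inward normals of the domain and the return time\<close>

text \<open>A small step from \<open>x\<close> along \<open>n - m\<close> enters
  \<open>\<Omega>\<close> according to \<open>n\<close> and leaves it according to \<open>m\<close>,
  because for unit vectors \<open>n \<bullet> (n - m)\<close> and
  \<open>- (m \<bullet> (n - m))\<close> both equal half the square of
  \<open>norm (n - m)\<close>.\<close>

lemma is_inward_normal_unique:
  assumes "is_inward_normal \<Omega> x n" "is_inward_normal \<Omega> x m"
  shows "n = m"
proof (rule ccontr)
  assume "n \<noteq> m"
  define k where "k = norm (n - m)"
  have k: "k > 0" unfolding k_def using \<open>n \<noteq> m\<close> by simp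
  have n1: "n \<bullet> n = 1" "m \<bullet> m = 1" using assms unfolding is_inward_normal_def by (auto simp: dot_square_norm)
  have kk: "k * k = 2 - 2 * (n \<bullet> m)"
    unfolding k_def by (simp add: power2_norm_eq_inner[symmetric] power2_eq_square[symmetric])
       (simp add: power2_norm_eq_inner inner_diff_left inner_diff_right n1 inner_commute)
  \<comment> \<open>Relative to its length the step has component \<open>k / 2\<close> along
    \<open>n\<close> and \<open>- (k / 2)\<close> along \<open>m\<close>, so the tolerance
    \<open>k / 4\<close> is met strictly on both sides.\<close>
  obtain r where r: "r > 0" "\<And>y. y \<in> ball x r \<Longrightarrow> n \<bullet> (y - x) > (k/4) * norm (y - x) \<Longrightarrow> y \<in> \<Omega>"
    using assms(1) k unfolding is_inward_normal_def by (metis divide_pos_pos zero_less_numeral)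
  obtain r' where r': "r' > 0" "\<And>y. y \<in> ball x r' \<Longrightarrow> m \<bullet> (y - x) < - (k/4) * norm (y - x) \<Longrightarrow> y \<notin> \<Omega>"
    using assms(2) k unfolding is_inward_normal_def by (metis divide_pos_pos zero_less_numeral)
  define s where "s = min r r' / (2 * k)"
  have s: "s > 0" unfolding s_def using r r' k by simp
  have sk: "s * k = min r r' / 2" unfolding s_def using k by simp
  define y where "y = x + s *\<^sub>R (n - m)"
  have ny: "norm (y - x) = s * k" unfolding y_def k_def using s by simp
  have inb: "y \<in> ball x r" "y \<in> ball x r'" using ny sk r r' by (auto simp: dist_norm norm_minus_commute)
  have ip: "n \<bullet> (y - x) = s * (k * k) / 2" "m \<bullet> (y - x) = - (s * (k * k) / 2)"
    unfolding y_def kk using n1 by (simp_all add: inner_diff_right inner_commute diff_divide_distrib algebra_simps)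
  have eq: "(k/4) * norm (y - x) = s * (k * k) / 4" unfolding ny by simp
  have pos: "s * (k * k) > 0" using s k by simp
  have "n \<bullet> (y - x) > (k/4) * norm (y - x)" unfolding eq ip using pos by linarith
  moreover have "m \<bullet> (y - x) < - (k/4) * norm (y - x)"
    unfolding mult_minus_left minus_divide_left[symmetric] eq ip using pos by linarith
  ultimately show False using r(2)[OF inb(1)] r'(2)[OF inb(2)] by blast
qed

lemma inward_normal_eq:
  assumes "is_inward_normal \<Omega> x n"
  shows "inward_normal \<Omega> x = n"
  unfolding inward_normal_def using assms is_inward_normal_unique by (intro the_equality) blast+

text \<open>Within a small ball the upper cone lies in the open set \<open>\<Omega>\<close> and the
  lower cone is an open set disjoint from \<open>\<Omega>\<close>, hence from its closure. The
  frontier is left with the thin region between the cones.\<close>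

lemma inward_normal_frontier_bound:
  assumes n: "is_inward_normal \<Omega> x n" and "open \<Omega>" and \<epsilon>: "\<epsilon> > 0"
  obtains r where "r > 0" "\<And>y. y \<in> ball x r \<Longrightarrow> y \<in> frontier \<Omega> \<Longrightarrow> \<bar>n \<bullet> (y - x)\<bar> \<le> \<epsilon> * norm (y - x)"
proof -
  obtain r where r: "r > 0" "\<And>y. y \<in> ball x r \<Longrightarrow> n \<bullet> (y - x) > \<epsilon> * norm (y - x) \<Longrightarrow> y \<in> \<Omega>"
     "\<And>y. y \<in> ball x r \<Longrightarrow> n \<bullet> (y - x) < - \<epsilon> * norm (y - x) \<Longrightarrow> y \<notin> \<Omega>"
    using n \<epsilon> unfolding is_inward_normal_def by metis
  show thesis
  proof (rule that[OF r(1)])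
    fix y assume y: "y \<in> ball x r" "y \<in> frontier \<Omega>"
    have "y \<notin> \<Omega>" using y(2) \<open>open \<Omega>\<close> by (simp add: frontier_def interior_open)
    then have up: "n \<bullet> (y - x) \<le> \<epsilon> * norm (y - x)" using r(2)[OF y(1)] by linarith
    define T where "T = ball x r \<inter> {z. n \<bullet> (z - x) < - \<epsilon> * norm (z - x)}"
    have "open T" unfolding T_def by (intro open_Int open_ball open_Collect_less continuous_intros)
    moreover have "T \<inter> \<Omega> = {}" unfolding T_def using r(3) by auto
    ultimately have "T \<inter> closure \<Omega> = {}" by (simp add: open_Int_closure_eq_empty)
    then have "y \<notin> T" using y(2) unfolding frontier_def by auto
    then have "- \<epsilon> * norm (y - x) \<le> n \<bullet> (y - x)" using y(1) unfolding T_def by auto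
    then show "\<bar>n \<bullet> (y - x)\<bar> \<le> \<epsilon> * norm (y - x)" using up by (simp add: abs_le_iff)
  qed
qed

text \<open>The frontier of \<open>\<Omega>\<close> deviates from the hyperplane orthogonal to
  \<open>n\<close> by \<open>o(\<Phi> y - \<Phi> c)\<close>, and differentiability of
  \<open>\<Phi>\<close> bounds \<open>\<Phi> y - \<Phi> c\<close> by a multiple of
  \<open>y - c\<close>. This yields orthogonality of \<open>n\<close> to the image of the derivative
  of \<open>\<Phi>\<close> from the normal at one point.\<close>

lemma inward_normal_component_has_derivative_zero:
  assumes n: "is_inward_normal \<Omega> (\<Phi> c) n" and "open \<Omega>"
    and \<Phi>: "\<And>y. y \<in> M \<Longrightarrow> \<Phi> y \<in> frontier \<Omega>" and L: "(\<Phi> has_derivative L) (at c within M)"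
  shows "((\<lambda>y. n \<bullet> \<Phi> y) has_derivative (\<lambda>_. 0)) (at c within M)"
  unfolding has_derivative_within_alt
proof (intro conjI allI impI)
  show "bounded_linear (\<lambda>_::'b. 0::real)" by (rule bounded_linear_zero)
  fix e :: real assume e: "e > 0"
  obtain B where B: "B > 0" "\<And>v. norm (L v) \<le> norm v * B"
    using bounded_linear.pos_bounded[OF has_derivative_bounded_linear[OF L]] by blast
  define \<epsilon> where "\<epsilon> = e / (B + 1)"
  have \<epsilon>: "\<epsilon> > 0" unfolding \<epsilon>_def using e B by simp
  obtain r where r: "r > 0" "\<And>y. y \<in> ball (\<Phi> c) r \<Longrightarrow> y \<in> frontier \<Omega> \<Longrightarrow> \<bar>n \<bullet> (y - \<Phi> c)\<bar> \<le> \<epsilon> * norm (y - \<Phi> c)"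
    using inward_normal_frontier_bound[OF n \<open>open \<Omega>\<close> \<epsilon>] by blast
  obtain d1 where d1: "d1 > 0" "\<And>y. y \<in> M \<Longrightarrow> norm (y - c) < d1 \<Longrightarrow> norm (\<Phi> y - \<Phi> c - L (y - c)) \<le> 1 * norm (y - c)"
    using L unfolding has_derivative_within_alt by (metis zero_less_one)
  define d where "d = min d1 (r / (B + 1))"
  have "d > 0" unfolding d_def using d1 r B by simp
  moreover have "norm (n \<bullet> \<Phi> y - n \<bullet> \<Phi> c - 0) \<le> e * norm (y - c)" if y: "y \<in> M" "norm (y - c) < d" for y
  proof -
    have "norm (\<Phi> y - \<Phi> c) \<le> norm (\<Phi> y - \<Phi> c - L (y - c)) + norm (L (y - c))"
      by (metis diff_add_cancel norm_triangle_ineq)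
    also have "\<dots> \<le> (B + 1) * norm (y - c)"
      using d1(2)[OF y(1)] y(2) B(2)[of "y - c"] unfolding d_def by (simp add: algebra_simps)
    finally have l: "norm (\<Phi> y - \<Phi> c) \<le> (B + 1) * norm (y - c)" .
    also have "\<dots> < r" using y(2) B unfolding d_def by (simp add: pos_less_divide_eq mult.commute)
    finally have "\<Phi> y \<in> ball (\<Phi> c) r" by (simp add: dist_norm norm_minus_commute)
    then have "\<bar>n \<bullet> (\<Phi> y - \<Phi> c)\<bar> \<le> \<epsilon> * norm (\<Phi> y - \<Phi> c)" using r(2) \<Phi>[OF y(1)] by blast
    also have "\<dots> \<le> \<epsilon> * ((B + 1) * norm (y - c))" using l \<epsilon> by (intro mult_left_mono) auto
    also have "\<dots> = e * norm (y - c)" unfolding \<epsilon>_def using B by simp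
    finally show ?thesis by (simp add: inner_diff_right)
  qed
  ultimately show "\<exists>d>0. \<forall>y\<in>M. norm (y - c) < d \<longrightarrow> norm (n \<bullet> \<Phi> y - n \<bullet> \<Phi> c - 0) \<le> e * norm (y - c)" by blast
qed

section \<open>The exit normal and the travel time back to the core\<close>

definition exit_normal :: "'a::euclidean_space set \<Rightarrow> 'a set \<Rightarrow> 'a \<Rightarrow> 'a" where
  "exit_normal C \<Omega> c = inward_normal \<Omega> (radial_map C \<Omega> c)"

definition return_time :: "'a::euclidean_space set \<Rightarrow> 'a set \<Rightarrow> 'a \<Rightarrow> real" where
  "return_time C \<Omega> c = (LEAST t. 0 \<le> t \<and> radial_map C \<Omega> c + t *\<^sub>R exit_normal C \<Omega> c \<in> C)"

lemma return_map_eq: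
  "return_map C \<Omega> c = radial_map C \<Omega> c + return_time C \<Omega> c *\<^sub>R exit_normal C \<Omega> c"
  unfolding return_map_def reciprocal_map_def return_time_def exit_normal_def by (simp add: Let_def)

context
  fixes C \<Omega> :: "'a::euclidean_space set" and c :: 'a
  assumes core: "convex_core C" and dom: "C2_domain C \<Omega>" and c: "c \<in> frontier C"
begin

lemma open_domain: "open \<Omega>"
  using dom unfolding C2_domain_def class_O_def by blast

lemma radial_map_frontier: "radial_map C \<Omega> c \<in> frontier \<Omega>" "radial_map C \<Omega> c \<notin> C"
  using dom c unfolding C2_domain_def return_map_defined_at_def by blast+

lemma is_inward_normal_exit_normal: "is_inward_normal \<Omega> (radial_map C \<Omega> c) (exit_normal C \<Omega> c)"
  using dom c inward_normal_eq unfolding C2_domain_def return_map_defined_at_def exit_normal_def by metis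

text \<open>A least real number with a given property need not exist. Here the set of admissible
  times is nonempty, bounded below and, since \<open>C\<close> is closed, closed; it therefore
  contains its infimum.\<close>

lemma return_time:
  shows return_time_nonneg: "0 \<le> return_time C \<Omega> c"
    and return_map_mem: "return_map C \<Omega> c \<in> C"
    and return_time_le: "0 \<le> s \<Longrightarrow> radial_map C \<Omega> c + s *\<^sub>R exit_normal C \<Omega> c \<in> C \<Longrightarrow> return_time C \<Omega> c \<le> s"
proof -
  define S where "S = {t. 0 \<le> t \<and> radial_map C \<Omega> c + t *\<^sub>R exit_normal C \<Omega> c \<in> C}"
  obtain n where "is_inward_normal \<Omega> (radial_map C \<Omega> c) n" "\<exists>t\<ge>0. radial_map C \<Omega> c + t *\<^sub>R n \<in> C"
    using dom c unfolding C2_domain_def return_map_defined_at_def by blast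
  then have "S \<noteq> {}" unfolding S_def exit_normal_def using inward_normal_eq by blast
  moreover have "closed S"
  proof -
    have "S = {0..} \<inter> (\<lambda>t. radial_map C \<Omega> c + t *\<^sub>R exit_normal C \<Omega> c) -` C" unfolding S_def by auto
    then show ?thesis
      by (auto intro!: closed_Int closed_vimage closed_convex_core[OF core] continuous_intros)
  qed
  moreover have bd: "bdd_below S" unfolding S_def by (auto intro!: bdd_belowI[of _ 0])
  ultimately have I: "Inf S \<in> S" by (intro closed_contains_Inf)
  have "return_time C \<Omega> c = Inf S"
    unfolding return_time_def using I bd by (intro Least_equality) (auto simp: S_def intro!: cInf_lower)
  then have R: "return_time C \<Omega> c \<in> S" "\<And>s. s \<in> S \<Longrightarrow> return_time C \<Omega> c \<le> s"
    using I cInf_lower[OF _ bd] by auto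
  then show "0 \<le> return_time C \<Omega> c" "return_map C \<Omega> c \<in> C"
    "0 \<le> s \<Longrightarrow> radial_map C \<Omega> c + s *\<^sub>R exit_normal C \<Omega> c \<in> C \<Longrightarrow> return_time C \<Omega> c \<le> s"
    unfolding S_def return_map_eq by auto
qed

text \<open>If the first hitting point were interior, the ray would have been in \<open>C\<close>
  slightly earlier. There is an earlier time because the starting point lies outside
  \<open>C\<close>.\<close>

lemma return_map_frontier: "return_map C \<Omega> c \<in> frontier C"
proof -
  let ?x = "radial_map C \<Omega> c" and ?n = "exit_normal C \<Omega> c" and ?t = "return_time C \<Omega> c"
  have "?t \<noteq> 0" using return_map_mem radial_map_frontier(2) unfolding return_map_eq by auto
  then have t: "?t > 0" using return_time_nonneg by simp
  have "?x + ?t *\<^sub>R ?n \<notin> interior C"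
  proof
    assume "?x + ?t *\<^sub>R ?n \<in> interior C"
    then obtain e where e: "e > 0" "ball (?x + ?t *\<^sub>R ?n) e \<subseteq> C" using mem_interior by blast
    define s where "s = min ?t (e / 2)"
    have s: "0 < s" "s \<le> ?t" "s < e" unfolding s_def using t e by auto
    have "norm ?n = 1" using is_inward_normal_exit_normal unfolding is_inward_normal_def by auto
    then have "?x + (?t - s) *\<^sub>R ?n \<in> ball (?x + ?t *\<^sub>R ?n) e"
      using s by (simp add: dist_norm algebra_simps)
    then have "?t \<le> ?t - s" using e s by (intro return_time_le) auto
    then show False using s by simp
  qed
  then show ?thesis using return_map_mem closed_convex_core[OF core] unfolding return_map_eq frontier_def by simp
qed

lemma thickness_pos: "0 < thickness C \<Omega> c"
proof -
  have "bdd_above (insert 0 (thickness_set C \<Omega> c))" using dom c unfolding C2_domain_def by simp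
  then have "0 \<le> thickness C \<Omega> c" unfolding thickness_def by (intro cSup_upper) auto
  moreover have "thickness C \<Omega> c \<noteq> 0"
    using radial_map_frontier(2) frontier_convex_coreD(1)[OF core c] unfolding radial_map_def by auto
  ultimately show ?thesis by simp
qed

text \<open>Since the thickness is a supremum, \<open>\<Omega>\<close> contains points of the ray
  just below \<open>\<Phi> c\<close>. A normal with positive component along \<open>\<nu>\<close>
  would put these points on the outer side of \<open>\<Omega>\<close>.\<close>

lemma exit_normal_outward_normal_nonpos: "exit_normal C \<Omega> c \<bullet> outward_normal C c \<le> 0"
proof (rule ccontr)
  let ?x = "radial_map C \<Omega> c" and ?n = "exit_normal C \<Omega> c" and ?d = "thickness C \<Omega> c" and ?\<nu> = "outward_normal C c"
  assume "\<not> ?thesis"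
  then have \<epsilon>: "?n \<bullet> ?\<nu> / 2 > 0" by simp
  obtain r where r: "r > 0"
     "\<And>y. y \<in> ball ?x r \<Longrightarrow> ?n \<bullet> (y - ?x) < - (?n \<bullet> ?\<nu> / 2) * norm (y - ?x) \<Longrightarrow> y \<notin> \<Omega>"
    using is_inward_normal_exit_normal \<epsilon> unfolding is_inward_normal_def by metis
  have bd: "bdd_above (insert 0 (thickness_set C \<Omega> c))" using dom c unfolding C2_domain_def by simp
  \<comment> \<open>The bound \<open>0\<close> excludes the inserted element \<open>0\<close>, so
    that \<open>s\<close> is a parameter whose point lies in \<open>\<Omega>\<close>.\<close>
  have "max (?d - r) 0 < Sup (insert 0 (thickness_set C \<Omega> c))"
    using r(1) thickness_pos unfolding thickness_def by simp
  then obtain s where s: "s \<in> insert 0 (thickness_set C \<Omega> c)" "max (?d - r) 0 < s"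
    using less_cSup_iff[OF _ bd] by blast
  then have s\<Omega>: "c + s *\<^sub>R ?\<nu> \<in> \<Omega>" unfolding thickness_set_def by auto
  have "s \<le> ?d" unfolding thickness_def by (rule cSup_upper[OF s(1) bd])
  moreover have "s \<noteq> ?d"
    using s\<Omega> radial_map_frontier(1) open_domain unfolding radial_map_def by (auto simp: frontier_def interior_open)
  ultimately have sd: "s < ?d" by simp
  have diff: "c + s *\<^sub>R ?\<nu> - ?x = - (?d - s) *\<^sub>R ?\<nu>" unfolding radial_map_def by (simp add: algebra_simps)
  have nrm: "norm (c + s *\<^sub>R ?\<nu> - ?x) = ?d - s" unfolding diff using sd norm_outward_normal[OF core c] by simp
  have "c + s *\<^sub>R ?\<nu> \<in> ball ?x r" using nrm s(2) by (simp add: dist_norm norm_minus_commute)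
  moreover have "?n \<bullet> (c + s *\<^sub>R ?\<nu> - ?x) < - (?n \<bullet> ?\<nu> / 2) * norm (c + s *\<^sub>R ?\<nu> - ?x)"
  proof -
    have "0 < (?n \<bullet> ?\<nu>) * (?d - s)" using sd \<epsilon> by simp
    moreover have "?n \<bullet> (- (?d - s) *\<^sub>R ?\<nu>) = - ((?n \<bullet> ?\<nu>) * (?d - s))" by (simp add: algebra_simps)
    moreover have "- (?n \<bullet> ?\<nu> / 2) * (?d - s) = - ((?n \<bullet> ?\<nu>) * (?d - s)) / 2" by simp
    ultimately show ?thesis unfolding nrm unfolding diff by linarith
  qed
  ultimately show False using r(2) s\<Omega> by blast
qed

end

section \<open>Linearization of the return map\<close>

lemma has_derivative_remainder_quotient:
  assumes "(f has_derivative f') (at x within S)"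
  shows "((\<lambda>y. norm (f y - f x - f' (y - x)) / norm (y - x)) \<longlongrightarrow> 0) (at x within S)"
  using assms unfolding has_derivative_iff_norm by blast

text \<open>Applied with \<open>z\<close> the tangential part of the inward normal of \<open>\<Omega>\<close> at \<open>\<Phi> x\<close>, \<open>A x = d x D\<nu>(x)\<close> and
  \<open>G = grad d\<close>. Positivity of \<open>A\<close> bounds the tangential part of \<open>z x - Z (x - c)\<close> by the residual of
  the equation, so that no inverse of \<open>I + A x\<close> away from \<open>c\<close> is needed.\<close>

lemma tangential_solution_has_derivative:
  fixes N z G Z G' :: "'a::euclidean_space \<Rightarrow> 'a" and A :: "'a \<Rightarrow> 'a \<Rightarrow>\<^sub>L 'a"
  assumes cS: "c \<in> S"
    and contN: "continuous (at c within S) N" and contA: "continuous (at c within S) A"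
    and G: "(G has_derivative G') (at c within S)" and Gc: "G c = 0"
    and N: "\<And>x. x \<in> S \<Longrightarrow> norm (N x) = 1"
    and Nz: "\<And>x. x \<in> S \<Longrightarrow> N x \<bullet> z x = 0" and NG: "\<And>x. x \<in> S \<Longrightarrow> N x \<bullet> G x = 0"
    and a: "\<And>x. x \<in> S \<Longrightarrow> 0 \<le> a x" "\<And>x. x \<in> S \<Longrightarrow> (a x)\<^sup>2 + (norm (z x))\<^sup>2 = 1"
    and eq: "\<And>x v. x \<in> S \<Longrightarrow> N x \<bullet> v = 0 \<Longrightarrow> z x \<bullet> (v + A x v) = a x * (G x \<bullet> v)"
    and zG: "\<And>x. x \<in> S \<Longrightarrow> norm (z x) \<le> norm (G x)"
    and Z: "bounded_linear Z" "\<And>h. N c \<bullet> Z h = 0"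
      "\<And>h v. N c \<bullet> v = 0 \<Longrightarrow> (Z h + A c (Z h)) \<bullet> v = G' h \<bullet> v"
    and sym: "\<And>u v. N c \<bullet> u = 0 \<Longrightarrow> N c \<bullet> v = 0 \<Longrightarrow> A c u \<bullet> v = u \<bullet> A c v"
    and psd: "\<And>v. N c \<bullet> v = 0 \<Longrightarrow> 0 \<le> A c v \<bullet> v"
    and NA: "\<And>v. N c \<bullet> A c v = 0"
  shows "(z has_derivative Z) (at c within S)"
proof -
  define r where "r = (\<lambda>x. norm (G x - G' (x - c)) / norm (x - c))"
  \<comment> \<open>\<open>\<kappa>\<close> collects all factors multiplying
    \<open>norm (z x)\<close> in the error. It tends to \<open>0\<close>, and \<open>z x\<close> is
    itself \<open>O(x - c)\<close> through \<open>zG\<close>, so their product is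
    \<open>o(x - c)\<close>.\<close>
  define \<kappa> where "\<kappa> = (\<lambda>x. norm (G x) + norm (A c - A x) + norm (N c - N x) * norm (A x) + norm (N c - N x))"
  obtain B where B: "B > 0" "\<And>v. norm (G' v) \<le> norm v * B"
    using bounded_linear.pos_bounded[OF has_derivative_bounded_linear[OF G]] by blast
  have zc: "z c = 0" using zG[OF cS] Gc by simp
  show ?thesis
  proof (rule has_derivativeI_sandwich[of 1, OF _ Z(1)])
    fix x assume x: "x \<in> S" "x \<noteq> c"
    define h where "h = x - c"
    have h: "norm h > 0" using x unfolding h_def by simp
    define \<rho> where "\<rho> = z x - Z h"
    \<comment> \<open>\<open>e\<close> is the error made tangent at \<open>c\<close>, where
      positivity and symmetry of \<open>A c\<close> are available; \<open>e'\<close> is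
      \<open>e\<close> made tangent at \<open>x\<close>, where it is an admissible test vector in
      \<open>eq\<close>.\<close>
    define e where "e = \<rho> - (N c \<bullet> \<rho>) *\<^sub>R N c"
    define e' where "e' = e - (N x \<bullet> e) *\<^sub>R N x"
    define \<eta> where "\<eta> = norm (N c - N x)"
    have NN: "N c \<bullet> N c = 1" "N x \<bullet> N x = 1" using N[OF cS] N[OF x(1)] by (auto simp: dot_square_norm)
    have Ne: "N c \<bullet> e = 0" unfolding e_def using NN by (simp add: inner_diff_right)
    have Ne': "N x \<bullet> e' = 0" unfolding e'_def using NN by (simp add: inner_diff_right)
    have \<rho>e: "\<rho> = e + (N c \<bullet> \<rho>) *\<^sub>R N c" unfolding e_def by simp
    have N\<rho>: "\<bar>N c \<bullet> \<rho>\<bar> \<le> \<eta> * norm (z x)"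
    proof -
      have "N c \<bullet> \<rho> = (N c - N x) \<bullet> z x"
        unfolding \<rho>_def using Z(2)[of h] Nz[OF x(1)] by (simp add: inner_diff_left inner_diff_right)
      then show ?thesis unfolding \<eta>_def by (simp add: Cauchy_Schwarz_ineq2)
    qed
    have Nxe: "\<bar>N x \<bullet> e\<bar> \<le> \<eta> * norm e"
    proof -
      have "N x \<bullet> e = - ((N c - N x) \<bullet> e)" using Ne by (simp add: inner_diff_left)
      then show ?thesis unfolding \<eta>_def by (simp add: Cauchy_Schwarz_ineq2)
    qed
    \<comment> \<open>An energy estimate: the residual is tested with \<open>e\<close> itself.
      Positivity makes \<open>I + A c\<close> coercive with constant \<open>1\<close>, and symmetry
      moves \<open>A c\<close> from \<open>e\<close> onto \<open>Z h\<close>.\<close>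
    have "norm e * norm e = e \<bullet> e" by (simp add: dot_square_norm power2_eq_square)
    also have "\<dots> \<le> e \<bullet> (e + A c e)" using psd[OF Ne] by (simp add: inner_add_right inner_commute)
    also have "\<dots> = \<rho> \<bullet> (e + A c e)"
      by (subst \<rho>e) (simp add: inner_add_left inner_add_right Ne NA)
    also have "\<dots> = z x \<bullet> (e + A c e) - (Z h + A c (Z h)) \<bullet> e"
      unfolding \<rho>_def using sym[OF Z(2) Ne, of h] by (simp add: inner_diff_left inner_add_left inner_add_right)
    also have "(Z h + A c (Z h)) \<bullet> e = G' h \<bullet> e" by (rule Z(3)[OF Ne])
    also have "z x \<bullet> (e + A c e) = z x \<bullet> (e' + A x e') + z x \<bullet> (A c e - A x e')"
      unfolding e'_def using Nz[OF x(1)] by (simp add: inner_add_right inner_diff_right inner_commute)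
    also have "z x \<bullet> (e' + A x e') = a x * (G x \<bullet> e)"
      by (subst eq[OF x(1) Ne']) (use NG[OF x(1)] in \<open>simp add: e'_def inner_diff_right inner_commute\<close>)
    finally have "norm e * norm e \<le> (a x *\<^sub>R G x - G' h) \<bullet> e + z x \<bullet> (A c e - A x e')"
      by (simp add: inner_diff_left)
    also have "\<dots> \<le> norm (a x *\<^sub>R G x - G' h) * norm e + norm (z x) * norm (A c e - A x e')"
      by (intro add_mono norm_cauchy_schwarz)
    also have "\<dots> \<le> norm (a x *\<^sub>R G x - G' h) * norm e
        + norm (z x) * ((norm (A c - A x) + \<eta> * norm (A x)) * norm e)"
    proof (intro add_left_mono mult_left_mono)
      have "A c e - A x e' = (A c - A x) e + (N x \<bullet> e) *\<^sub>R A x (N x)"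
        unfolding e'_def by (simp add: blinfun.diff_left blinfun.diff_right blinfun.scaleR_right)
      then have "norm (A c e - A x e') \<le> norm ((A c - A x) e) + \<bar>N x \<bullet> e\<bar> * norm (A x (N x))"
        by (metis norm_triangle_ineq norm_scaleR)
      also have "\<dots> \<le> norm (A c - A x) * norm e + (\<eta> * norm e) * norm (A x)"
      proof (intro add_mono mult_mono norm_blinfun Nxe)
        show "norm (A x (N x)) \<le> norm (A x)" using norm_blinfun[of "A x" "N x"] N[OF x(1)] by simp
      qed (auto simp: \<eta>_def)
      finally show "norm (A c e - A x e') \<le> (norm (A c - A x) + \<eta> * norm (A x)) * norm e"
        by (simp add: algebra_simps)
    qed auto
    also have "\<dots> = (norm (a x *\<^sub>R G x - G' h) + norm (z x) * (norm (A c - A x) + \<eta> * norm (A x))) * norm e"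
      by (simp add: algebra_simps)
    finally have e1: "norm e \<le> norm (a x *\<^sub>R G x - G' h) + norm (z x) * (norm (A c - A x) + \<eta> * norm (A x))"
    proof (cases "e = 0")
      case True
      then show ?thesis by (simp add: \<eta>_def)
    qed (simp add: mult_le_cancel_right)
    have "norm (a x *\<^sub>R G x - G' h) \<le> norm (G x - G' h) + norm (z x) * norm (G x)"
    proof -
      \<comment> \<open>Replacing \<open>a x\<close> by \<open>1\<close> costs at most
        \<open>norm (z x) * norm (G x)\<close>, a quadratically small term.\<close>
      have "1 \<le> (a x + norm (z x))\<^sup>2" using a[OF x(1)] by (simp add: power2_sum)
      then have "1 \<le> a x + norm (z x)" using a(1)[OF x(1)]
        by (smt (verit) norm_ge_zero power2_le_imp_le one_power2)
      moreover have "a x \<le> 1" using a[OF x(1)] by (smt (verit) one_power2 power2_le_imp_le zero_le_power2)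
      ultimately have "\<bar>a x - 1\<bar> \<le> norm (z x)" by simp
      then have "norm ((a x - 1) *\<^sub>R G x) \<le> norm (z x) * norm (G x)" by (simp add: mult_right_mono)
      moreover have "a x *\<^sub>R G x - G' h = (G x - G' h) + (a x - 1) *\<^sub>R G x" by (simp add: algebra_simps)
      ultimately show ?thesis by (metis (no_types, lifting) add_left_mono norm_triangle_ineq order_trans)
    qed
    then have "norm e + \<bar>N c \<bullet> \<rho>\<bar> \<le> norm (G x - G' h) + norm (z x) * \<kappa> x"
      using e1 N\<rho> unfolding \<kappa>_def \<eta>_def by (simp add: algebra_simps)
    moreover have "norm \<rho> \<le> norm e + \<bar>N c \<bullet> \<rho>\<bar>"
      using norm_triangle_ineq[of e "(N c \<bullet> \<rho>) *\<^sub>R N c"] N[OF cS] \<rho>e by simp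
    moreover have "norm (z x) * \<kappa> x \<le> (norm (G x - G' h) + norm h * B) * \<kappa> x"
    proof (rule mult_right_mono)
      have "norm (G x) \<le> norm (G x - G' h) + norm (G' h)" by (metis diff_add_cancel norm_triangle_ineq)
      then show "norm (z x) \<le> norm (G x - G' h) + norm h * B" using zG[OF x(1)] B(2)[of h] by linarith
    qed (auto simp: \<kappa>_def)
    ultimately have "norm \<rho> \<le> norm (G x - G' h) + (norm (G x - G' h) + norm h * B) * \<kappa> x" by linarith
    then have "norm \<rho> / norm h \<le> (norm (G x - G' h) + (norm (G x - G' h) + norm h * B) * \<kappa> x) / norm h"
      using h by (simp add: divide_right_mono)
    also have "\<dots> = r x + (r x + B) * \<kappa> x"
      unfolding r_def using h by (simp add: h_def[symmetric] add_divide_distrib algebra_simps)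
    finally show "norm (z x - z c - Z (x - c)) / norm (x - c) \<le> r x + (r x + B) * \<kappa> x"
      unfolding \<rho>_def h_def zc by simp
  next
    have r0: "(r \<longlongrightarrow> 0) (at c within S)"
      using has_derivative_remainder_quotient[OF G] unfolding r_def Gc by simp
    have "(G \<longlongrightarrow> 0) (at c within S)"
      using has_derivative_continuous[OF G] Gc by (simp add: continuous_within)
    moreover have "(A \<longlongrightarrow> A c) (at c within S)" "(N \<longlongrightarrow> N c) (at c within S)"
      using contA contN by (simp_all add: continuous_within)
    ultimately have "(\<kappa> \<longlongrightarrow> norm (0::'a) + norm (A c - A c) + norm (N c - N c) * norm (A c) + norm (N c - N c)) (at c within S)"
      unfolding \<kappa>_def by (intro tendsto_intros)
    then have "(\<kappa> \<longlongrightarrow> 0) (at c within S)" by simp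
    then have "((\<lambda>x. r x + (r x + B) * \<kappa> x) \<longlongrightarrow> 0 + (0 + B) * 0) (at c within S)"
      by (intro tendsto_intros r0)
    then show "((\<lambda>x. r x + (r x + B) * \<kappa> x) \<longlongrightarrow> 0) (at c within S)" by simp
  qed simp
qed

text \<open>The component of \<open>F x - c\<close> along \<open>\<nu>\<close> is \<open>o(F x - c)\<close> because \<open>F x\<close> lies on the hypersurface \<open>M\<close>.
  As the remaining terms are tangent to first order, this forces \<open>\<tau> x = o(x - c)\<close> without any
  differentiability of \<open>\<tau>\<close> or \<open>t\<close>.\<close>

lemma normal_remainder_negligible:
  fixes N z Z F :: "'a::euclidean_space \<Rightarrow> 'a" and \<tau> t :: "'a \<Rightarrow> real"
  assumes cS: "c \<in> S"
    and N: "(N \<longlongrightarrow> \<nu>) (at c within S)" "\<And>x. x \<in> S \<Longrightarrow> norm (N x) = 1" and \<nu>: "norm \<nu> = 1"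
    and z: "(z has_derivative Z) (at c within S)" "z c = 0" "\<And>h. \<nu> \<bullet> Z h = 0"
    and t: "(t \<longlongrightarrow> t0) (at c within S)" and \<tau>: "(\<tau> \<longlongrightarrow> 0) (at c within S)"
    and F: "\<And>x. x \<in> S \<Longrightarrow> F x = x + \<tau> x *\<^sub>R N x + t x *\<^sub>R z x" "\<tau> c = 0"
    and FM: "\<And>x. x \<in> S \<Longrightarrow> F x \<in> M" and SM: "S \<subseteq> M"
    and flat: "((\<lambda>y. \<nu> \<bullet> y) has_derivative (\<lambda>_. 0)) (at c within M)"
  shows "(F has_derivative (\<lambda>h. h + t0 *\<^sub>R Z h)) (at c within S)"
proof -
  \<comment> \<open>Division by zero gives \<open>q c = 0\<close>, so \<open>q\<close> is continuous
    at \<open>c\<close> within \<open>M\<close> and can be composed with \<open>F\<close>, also at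
    points where \<open>F x = c\<close>.\<close>
  define q where "q = (\<lambda>y. norm (\<nu> \<bullet> y - \<nu> \<bullet> c) / norm (y - c))"
  have qM: "(q \<longlongrightarrow> 0) (at c within M)"
    using has_derivative_remainder_quotient[OF flat] unfolding q_def by simp
  then have qS: "(q \<longlongrightarrow> 0) (at c within S)" using SM tendsto_within_subset by blast
  have Fc: "F c = c" using F cS z(2) by simp
  have zlim: "(z \<longlongrightarrow> 0) (at c within S)"
    using has_derivative_continuous[OF z(1)] z(2) by (simp add: continuous_within)
  have "((\<lambda>x. x + \<tau> x *\<^sub>R N x + t x *\<^sub>R z x) \<longlongrightarrow> c + 0 *\<^sub>R \<nu> + t0 *\<^sub>R 0) (at c within S)"
    by (intro tendsto_intros \<tau> N t zlim)
  then have "(F \<longlongrightarrow> c) (at c within S)"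
    using F by (subst tendsto_cong[of _ "\<lambda>x. x + \<tau> x *\<^sub>R N x + t x *\<^sub>R z x"]) (auto simp: eventually_at_filter)
  then have contF: "continuous (at c within S) F" using Fc by (simp add: continuous_within)
  have "continuous (at (F c) within F ` S) q"
    using tendsto_within_subset[OF qM, of "F ` S"] FM Fc unfolding continuous_within by (auto simp: q_def)
  then have "continuous (at c within S) (\<lambda>x. q (F x))"
    using continuous_within_compose[OF contF] by (simp add: o_def)
  then have qF: "((\<lambda>x. q (F x)) \<longlongrightarrow> 0) (at c within S)" unfolding continuous_within Fc by (simp add: q_def)
  have qmul: "\<bar>\<nu> \<bullet> (y - c)\<bar> = q y * norm (y - c)" for y
    unfolding q_def by (simp add: inner_diff_right)
  define \<zeta> where "\<zeta> = (\<lambda>x. norm (z x - Z (x - c)) / norm (x - c))"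
  have \<zeta>0: "(\<zeta> \<longlongrightarrow> 0) (at c within S)"
    using has_derivative_remainder_quotient[OF z(1)] unfolding \<zeta>_def z(2) by simp
  obtain B where B: "B > 0" "\<And>v. norm (Z v) \<le> norm v * B"
    using bounded_linear.pos_bounded[OF has_derivative_bounded_linear[OF z(1)]] by blast
  interpret Z: bounded_linear Z by (rule has_derivative_bounded_linear[OF z(1)])
  \<comment> \<open>The estimate for \<open>\<nu> \<bullet> (F x - c)\<close> contains
    \<open>q (F x) * \<bar>\<tau> x\<bar>\<close> itself. This is absorbed on the left, where the
    coefficient of \<open>\<bar>\<tau> x\<bar>\<close> stays above \<open>1/2\<close>; hence the
    factor \<open>2\<close> in \<open>H\<close>.\<close>
  have small: "eventually (\<lambda>x. \<bar>\<nu> \<bullet> N x\<bar> - q (F x) > 1/2) (at c within S)"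
  proof (rule order_tendstoD)
    show "((\<lambda>x. \<bar>\<nu> \<bullet> N x\<bar> - q (F x)) \<longlongrightarrow> \<bar>\<nu> \<bullet> \<nu>\<bar> - 0) (at c within S)"
      by (intro tendsto_intros N qF)
    show "1/2 < \<bar>\<nu> \<bullet> \<nu>\<bar> - 0" using \<nu> by (simp add: dot_square_norm)
  qed
  define H where "H = (\<lambda>x. 2 * (q (F x) * (1 + \<bar>t x\<bar> * (\<zeta> x + B)) + q x + \<bar>t x\<bar> * \<zeta> x))"
  have H0: "(H \<longlongrightarrow> 0) (at c within S)"
  proof -
    have "(H \<longlongrightarrow> 2 * (0 * (1 + \<bar>t0\<bar> * (0 + B)) + 0 + \<bar>t0\<bar> * 0)) (at c within S)"
      unfolding H_def by (intro tendsto_intros qF t \<zeta>0 qS)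
    then show ?thesis by simp
  qed
  have \<tau>H: "\<bar>\<tau> x\<bar> \<le> H x * norm (x - c)" if x: "x \<in> S" "x \<noteq> c" and half: "\<bar>\<nu> \<bullet> N x\<bar> - q (F x) > 1/2" for x
  proof -
    define h where "h = x - c"
    have h: "norm h > 0" using x unfolding h_def by simp
    have zr: "norm (z x - Z h) = \<zeta> x * norm h" unfolding \<zeta>_def h_def using x by simp
    have zb: "norm (z x) \<le> (\<zeta> x + B) * norm h"
    proof -
      have "norm (z x) \<le> norm (z x - Z h) + norm (Z h)" by (metis diff_add_cancel norm_triangle_ineq)
      then show ?thesis using zr B(2)[of h] by (simp add: algebra_simps)
    qed
    have \<nu>z: "\<bar>\<nu> \<bullet> z x\<bar> \<le> \<zeta> x * norm h"
    proof -
      have "\<nu> \<bullet> z x = \<nu> \<bullet> (z x - Z h)" using z(3) by (simp add: inner_diff_right)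
      then show ?thesis using Cauchy_Schwarz_ineq2[of \<nu> "z x - Z h"] \<nu> zr by simp
    qed
    have qpos: "q y \<ge> 0" for y unfolding q_def by simp
    have Fx: "F x - c = h + \<tau> x *\<^sub>R N x + t x *\<^sub>R z x" using F(1)[OF x(1)] unfolding h_def by simp
    have nF: "norm (F x - c) \<le> norm h + \<bar>\<tau> x\<bar> + \<bar>t x\<bar> * ((\<zeta> x + B) * norm h)"
    proof -
      have "norm (F x - c) \<le> norm h + norm (\<tau> x *\<^sub>R N x) + norm (t x *\<^sub>R z x)"
        unfolding Fx by (meson norm_triangle_ineq norm_triangle_mono order_refl)
      also have "\<dots> = norm h + \<bar>\<tau> x\<bar> + \<bar>t x\<bar> * norm (z x)" using N(2)[OF x(1)] by simp
      also have "\<dots> \<le> norm h + \<bar>\<tau> x\<bar> + \<bar>t x\<bar> * ((\<zeta> x + B) * norm h)"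
        using zb by (intro add_left_mono mult_left_mono) auto
      finally show ?thesis .
    qed
    have "\<nu> \<bullet> (F x - c) = \<nu> \<bullet> h + \<tau> x * (\<nu> \<bullet> N x) + t x * (\<nu> \<bullet> z x)"
      unfolding Fx by (simp add: inner_add_right)
    then have "\<bar>\<tau> x * (\<nu> \<bullet> N x)\<bar> \<le> \<bar>\<nu> \<bullet> (F x - c)\<bar> + \<bar>\<nu> \<bullet> h\<bar> + \<bar>t x * (\<nu> \<bullet> z x)\<bar>" by linarith
    then have "\<bar>\<tau> x\<bar> * \<bar>\<nu> \<bullet> N x\<bar> \<le> q (F x) * norm (F x - c) + q x * norm h + \<bar>t x\<bar> * \<bar>\<nu> \<bullet> z x\<bar>"
      unfolding qmul h_def by (simp add: abs_mult)
    also have "\<dots> \<le> q (F x) * (norm h + \<bar>\<tau> x\<bar> + \<bar>t x\<bar> * ((\<zeta> x + B) * norm h)) + q x * norm h + \<bar>t x\<bar> * (\<zeta> x * norm h)"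
      by (intro add_mono mult_left_mono nF \<nu>z qpos order_refl) auto
    finally have "\<bar>\<tau> x\<bar> * (\<bar>\<nu> \<bullet> N x\<bar> - q (F x)) \<le> (H x / 2) * norm h"
      unfolding H_def by (simp add: algebra_simps)
    moreover have "\<bar>\<tau> x\<bar> * (1/2) \<le> \<bar>\<tau> x\<bar> * (\<bar>\<nu> \<bullet> N x\<bar> - q (F x))"
      using half by (intro mult_left_mono) auto
    ultimately show ?thesis unfolding h_def by simp
  qed
  obtain d where d: "d > 0" "\<And>x. x \<in> S \<Longrightarrow> x \<noteq> c \<Longrightarrow> dist x c < d \<Longrightarrow> \<bar>\<nu> \<bullet> N x\<bar> - q (F x) > 1/2"
    using small unfolding eventually_at by metis
  show ?thesis
  proof (rule has_derivativeI_sandwich[OF d(1)])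
    show "bounded_linear (\<lambda>h. h + t0 *\<^sub>R Z h)"
      by (intro bounded_linear_add bounded_linear_ident bounded_linear_scaleR_right[THEN bounded_linear_compose] Z.bounded_linear_axioms)
    fix x assume x: "x \<in> S" "x \<noteq> c" "dist x c < d"
    define h where "h = x - c"
    have h: "norm h > 0" using x unfolding h_def by simp
    have zr: "norm (z x - Z h) = \<zeta> x * norm h" unfolding \<zeta>_def h_def using x by simp
    have "F x - F c - (h + t0 *\<^sub>R Z h) = \<tau> x *\<^sub>R N x + t x *\<^sub>R (z x - Z h) + (t x - t0) *\<^sub>R Z h"
      unfolding Fc F(1)[OF x(1)] h_def by (simp add: algebra_simps)
    then have "norm (F x - F c - (h + t0 *\<^sub>R Z h)) \<le> norm (\<tau> x *\<^sub>R N x) + norm (t x *\<^sub>R (z x - Z h)) + norm ((t x - t0) *\<^sub>R Z h)"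
      by (metis norm_triangle_ineq norm_triangle_mono order_refl)
    also have "\<dots> = \<bar>\<tau> x\<bar> + \<bar>t x\<bar> * (\<zeta> x * norm h) + \<bar>t x - t0\<bar> * norm (Z h)"
      using N(2)[OF x(1)] zr by simp
    also have "\<dots> \<le> H x * norm h + \<bar>t x\<bar> * (\<zeta> x * norm h) + \<bar>t x - t0\<bar> * (norm h * B)"
      using \<tau>H[OF x(1,2) d(2)[OF x]] B(2)[of h] unfolding h_def
      by (intro add_mono order_refl mult_left_mono) auto
    finally have "norm (F x - F c - (h + t0 *\<^sub>R Z h)) / norm h
        \<le> (H x * norm h + \<bar>t x\<bar> * (\<zeta> x * norm h) + \<bar>t x - t0\<bar> * (norm h * B)) / norm h"
      using h by (simp add: divide_right_mono)
    also have "\<dots> = H x + \<bar>t x\<bar> * \<zeta> x + \<bar>t x - t0\<bar> * B"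
      using h by (simp add: add_divide_distrib)
    finally show "norm (F x - F c - ((x - c) + t0 *\<^sub>R Z (x - c))) / norm (x - c) \<le> H x + \<bar>t x\<bar> * \<zeta> x + \<bar>t x - t0\<bar> * B"
      unfolding h_def .
  next
    have "((\<lambda>x. H x + \<bar>t x\<bar> * \<zeta> x + \<bar>t x - t0\<bar> * B) \<longlongrightarrow> 0 + \<bar>t0\<bar> * 0 + \<bar>t0 - t0\<bar> * B) (at c within S)"
      by (intro tendsto_intros H0 t \<zeta>0)
    then show "((\<lambda>x. H x + \<bar>t x\<bar> * \<zeta> x + \<bar>t x - t0\<bar> * B) \<longlongrightarrow> 0) (at c within S)" by simp
  qed
qed

section \<open>Surface derivatives from ambient extensions\<close>

lemma has_derivative_within_transfer:
  assumes "(f has_derivative f') (at x)" "open W" "x \<in> M \<inter> W" "\<And>y. y \<in> M \<inter> W \<Longrightarrow> g y = f y"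
  shows "(g has_derivative f') (at x within M)"
proof -
  have "(g has_derivative f') (at x within M \<inter> W)"
    by (rule has_derivative_transform[OF assms(3) _ has_derivative_at_withinI[OF assms(1)]]) (simp add: assms(4))
  moreover have "at x within M \<inter> W = at x within M"
    using assms(2,3) by (intro at_within_nhd[of x W]) auto
  ultimately show ?thesis by simp
qed

lemma surface_gradient_eq:
  assumes C: "convex_core C" "x \<in> frontier C"
    and f: "(f has_derivative (\<lambda>v. g \<bullet> v)) (at x within frontier C)"
  shows "surface_gradient C f x = g - (outward_normal C x \<bullet> g) *\<^sub>R outward_normal C x"
  unfolding surface_gradient_def
proof (rule the_equality)
  have \<nu>: "outward_normal C x \<bullet> outward_normal C x = 1"
    using norm_outward_normal[OF C] by (simp add: dot_square_norm)
  let ?G = "g - (outward_normal C x \<bullet> g) *\<^sub>R outward_normal C x"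
  have T: "?G \<in> tangent_space C x" using \<nu> unfolding tangent_space_def by (simp add: inner_diff_right)
  have D: "frechet_derivative f (at x within frontier C) v = ?G \<bullet> v" if "v \<in> tangent_space C x" for v
    using that frechet_derivative_frontier[OF C that f] unfolding tangent_space_def by (simp add: inner_diff_left)
  show "?G \<in> tangent_space C x \<and> (\<forall>v\<in>tangent_space C x. frechet_derivative f (at x within frontier C) v = ?G \<bullet> v)"
    using T D by blast
  fix k assume k: "k \<in> tangent_space C x \<and> (\<forall>v\<in>tangent_space C x. frechet_derivative f (at x within frontier C) v = k \<bullet> v)"
  have "k - ?G \<in> tangent_space C x" using k T unfolding tangent_space_def by (simp add: inner_diff_right)
  then have "k \<bullet> (k - ?G) = ?G \<bullet> (k - ?G)" using k D by metis
  then have "(k - ?G) \<bullet> (k - ?G) = 0" by (simp only: inner_diff_left)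
  then show "k = ?G" by simp
qed

text \<open>The shape operator is determined only on tangent vectors. \<open>D\<close> is a linear
  representative on the whole space with tangent values, which allows its resolvent to be formed in
  the ambient space.\<close>

lemma shape_operator_derivative:
  assumes C: "convex_core C" "c \<in> frontier C"
  obtains D where "linear D" "\<And>v. outward_normal C c \<bullet> D v = 0"
    "\<And>v. v \<in> tangent_space C c \<Longrightarrow> shape_operator C c v = - D v"
    "\<And>v. v \<in> tangent_space C c \<Longrightarrow> 0 \<le> D v \<bullet> v"
proof -
  obtain U N N' where U: "open U" "c \<in> U"
    and N: "\<forall>x\<in>U. (N has_derivative blinfun_apply (N' x)) (at x)"
    "continuous_on U N'" "\<forall>x\<in>U. norm (N x) = 1"
    "\<forall>x\<in>frontier C \<inter> U. outward_normal C x = N x"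
    "\<forall>x\<in>frontier C \<inter> U. \<forall>u\<in>tangent_space C x. \<forall>v\<in>tangent_space C x. N' x u \<bullet> v = u \<bullet> N' x v"
    using local_unit_normal[OF C] .
  have D: "(outward_normal C has_derivative N' c) (at c within frontier C)"
    by (rule has_derivative_within_transfer[OF bspec[OF N(1) U(2)] U(1)]) (use U(2) C(2) N(4) in auto)
  show thesis
  proof (rule that)
    show "linear (N' c)" by (simp add: blinfun.bounded_linear_right bounded_linear.linear)
    show "outward_normal C c \<bullet> N' c v = 0" for v
      using unit_field_derivative_orthogonal[OF U bspec[OF N(1) U(2)]] N(3,4) U(2) C(2) by auto
    show "shape_operator C c v = - N' c v" if "v \<in> tangent_space C c" for v
      unfolding shape_operator_def using frechet_derivative_frontier[OF C that D] by simp
    show "0 \<le> N' c v \<bullet> v" if "v \<in> tangent_space C c" for v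
      using outward_normal_derivative_nonneg[OF C that D] .
  qed
qed

text \<open>At a critical point the exit direction is \<open>-\<nu>\<close>, so the ray retraces
  itself and the travel time is \<open>d c\<close>. \<open>Z\<close> is described by the equation it
  solves, which identifies it once an inverse of \<open>I - d S\<close> on the tangent space is
  fixed.\<close>

lemma return_map_has_derivative:
  fixes C \<Omega> :: "'a::euclidean_space set"
  assumes core: "convex_core C" and dom: "C2_domain C \<Omega>" and c: "c \<in> frontier C"
    and crit: "surface_gradient C (thickness C \<Omega>) c = 0"
  obtains Z where
    "(return_map C \<Omega> has_derivative (\<lambda>v. v + thickness C \<Omega> c *\<^sub>R Z v)) (at c within frontier C)"
    "\<And>v. v \<in> tangent_space C c \<Longrightarrow> Z v \<in> tangent_space C c"
    "\<And>v. v \<in> tangent_space C c \<Longrightarrow>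
       Z v - thickness C \<Omega> c *\<^sub>R shape_operator C c (Z v) = thickness_hessian C \<Omega> c v"
    "linear (thickness_hessian C \<Omega> c)"
proof -
  define \<nu> where "\<nu> = outward_normal C"
  define d where "d = thickness C \<Omega>"
  define n where "n = exit_normal C \<Omega>"
  define t where "t = return_time C \<Omega>"
  obtain U N N' where U: "open U" "c \<in> U"
    and N: "\<forall>x\<in>U. (N has_derivative blinfun_apply (N' x)) (at x)"
    "continuous_on U N'" "\<forall>x\<in>U. norm (N x) = 1"
    "\<forall>x\<in>frontier C \<inter> U. outward_normal C x = N x"
    "\<forall>x\<in>frontier C \<inter> U. \<forall>u\<in>tangent_space C x. \<forall>v\<in>tangent_space C x. N' x u \<bullet> v = u \<bullet> N' x v"
    using local_unit_normal[OF core c] .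
  have "C2_on_hypersurface (frontier C) d" using dom unfolding C2_domain_def d_def by blast
  then obtain V \<phi> \<psi> where V: "open V" "c \<in> V" and C2: "C2_with_gradient V \<phi> \<psi>" and \<phi>: "\<forall>x\<in>frontier C \<inter> V. \<phi> x = d x"
    using c unfolding C2_on_hypersurface_def by blast
  have \<phi>': "\<forall>x\<in>V. (\<phi> has_derivative (\<lambda>v. \<psi> x \<bullet> v)) (at x)" using C2 unfolding C2_with_gradient_def by blast
  obtain H where H: "(\<psi> has_derivative blinfun_apply H) (at c)" using C2 V unfolding C2_with_gradient_def by blast
  define W where "W = U \<inter> V"
  define S where "S = frontier C \<inter> W"
  have W: "open W" "c \<in> W" using U V unfolding W_def by auto
  have cS: "c \<in> S" using c W unfolding S_def by simp
  have SD: "x \<in> frontier C" "x \<in> U" "x \<in> V" "x \<in> frontier C \<inter> W" if "x \<in> S" for x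
    using that unfolding S_def W_def by auto
  have atS: "at c within S = at c within frontier C"
    unfolding S_def using W by (intro at_within_nhd[of c W]) auto
  have \<nu>N: "\<nu> x = N x" if "x \<in> S" for x using N(4) SD[OF that] unfolding \<nu>_def by blast
  have normN: "norm (N x) = 1" if "x \<in> S" for x using N(3) SD[OF that] by blast
  have NN: "N x \<bullet> N x = 1" if "x \<in> S" for x using normN[OF that] by (simp add: dot_square_norm)
  have NN': "N x \<bullet> N' x v = 0" if "x \<in> S" for x v
    using unit_field_derivative_orthogonal[OF U(1) SD(2)[OF that] bspec[OF N(1) SD(2)[OF that]]] N(3) by blast
  have T: "v \<in> tangent_space C x \<longleftrightarrow> N x \<bullet> v = 0" if "x \<in> S" for x v
    using \<nu>N[OF that] unfolding tangent_space_def \<nu>_def by simp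
  have D\<nu>: "(outward_normal C has_derivative N' x) (at x within frontier C)" if "x \<in> S" for x
    by (rule has_derivative_within_transfer[OF bspec[OF N(1) SD(2)[OF that]] W(1) SD(4)[OF that]])
       (use \<nu>N in \<open>auto simp: \<nu>_def S_def\<close>)
  have Dd: "(thickness C \<Omega> has_derivative (\<lambda>v. \<psi> x \<bullet> v)) (at x within frontier C)" if "x \<in> S" for x
    by (rule has_derivative_within_transfer[OF bspec[OF \<phi>' SD(3)[OF that]] W(1) SD(4)[OF that]])
       (use \<phi> in \<open>auto simp: d_def W_def\<close>)
  have dpos: "0 < d x" if "x \<in> S" for x unfolding d_def by (rule thickness_pos[OF core dom SD(1)[OF that]])
  have psd: "0 \<le> N' x v \<bullet> v" if "x \<in> S" "N x \<bullet> v = 0" for x v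
    using outward_normal_derivative_nonneg[OF core SD(1)[OF that(1)] _ D\<nu>[OF that(1)]] T[OF that(1)] that(2) by blast

  \<comment> \<open>The tangential projection of the ambient gradient, formed with the extended
    normal \<open>N\<close>: it agrees with the surface gradient on \<open>S\<close> and is
    differentiable in the ambient sense.\<close>
  define G where "G = (\<lambda>x. \<psi> x - (N x \<bullet> \<psi> x) *\<^sub>R N x)"
  define G' where "G' = (\<lambda>v. H v - ((N c \<bullet> \<psi> c) *\<^sub>R N' c v + (N c \<bullet> H v + N' c v \<bullet> \<psi> c) *\<^sub>R N c))"
  have DG: "(G has_derivative G') (at c)"
    unfolding G_def G'_def
    by (intro has_derivative_diff H has_derivative_scaleR has_derivative_inner bspec[OF N(1) U(2)])
  have sg: "surface_gradient C (thickness C \<Omega>) x = G x" if "x \<in> S" for x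
    unfolding surface_gradient_eq[OF core SD(1)[OF that] Dd[OF that]] G_def using \<nu>N[OF that] unfolding \<nu>_def by simp
  have Dsg: "(surface_gradient C (thickness C \<Omega>) has_derivative G') (at c within frontier C)"
    by (rule has_derivative_within_transfer[OF DG W(1) SD(4)[OF cS]]) (use sg in \<open>auto simp: S_def\<close>)
  have Gc: "G c = 0" using crit sg[OF cS] by simp
  have NG: "N x \<bullet> G x = 0" if "x \<in> S" for x unfolding G_def using NN[OF that] by (simp add: inner_diff_right)
  have G\<psi>: "G x \<bullet> v = \<psi> x \<bullet> v" if "N x \<bullet> v = 0" for x v unfolding G_def using that by (simp add: inner_diff_left)
  interpret G': bounded_linear G' by (rule has_derivative_bounded_linear[OF DG])
  define P where "P = (\<lambda>w. w - (N c \<bullet> w) *\<^sub>R N c)"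
  have hess: "thickness_hessian C \<Omega> c v = P (G' v)" if "v \<in> tangent_space C c" for v
    unfolding surface_hessian_def frechet_derivative_frontier[OF core c that Dsg] P_def
    using \<nu>N[OF cS] unfolding \<nu>_def by (simp add: Let_def)

  define a where "a = (\<lambda>x. - (n x \<bullet> N x))"
  define z where "z = (\<lambda>x. n x + a x *\<^sub>R N x)"
  have nz: "n x = z x - a x *\<^sub>R N x" for x unfolding z_def by simp
  have inn: "is_inward_normal \<Omega> (radial_map C \<Omega> x) (n x)" if "x \<in> S" for x
    unfolding n_def by (rule is_inward_normal_exit_normal[OF core dom SD(1)[OF that]])
  have nn: "n x \<bullet> n x = 1" if "x \<in> S" for x
    using inn[OF that] unfolding is_inward_normal_def by (simp add: dot_square_norm)
  have a0: "0 \<le> a x" if "x \<in> S" for x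
    using exit_normal_outward_normal_nonpos[OF core dom SD(1)[OF that]] \<nu>N[OF that] unfolding a_def n_def \<nu>_def by simp
  have Nz: "N x \<bullet> z x = 0" if "x \<in> S" for x
    unfolding z_def a_def using NN[OF that] by (simp add: inner_diff_right inner_commute)
  have az: "(a x)\<^sup>2 + (norm (z x))\<^sup>2 = 1" if "x \<in> S" for x
    unfolding power2_norm_eq_inner power2_eq_square[of "a x"]
    using nn[OF that] unfolding nz using Nz[OF that] NN[OF that]
    by (simp add: inner_diff_left inner_diff_right inner_commute)
  define A where "A = (\<lambda>x. d x *\<^sub>R N' x)"
  have radial: "radial_map C \<Omega> x = x + d x *\<^sub>R \<nu> x" for x unfolding radial_map_def d_def \<nu>_def by simp
  have Dradial: "(radial_map C \<Omega> has_derivative (\<lambda>v. v + (d x *\<^sub>R N' x v + (\<psi> x \<bullet> v) *\<^sub>R N x))) (at x within frontier C)"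
    if "x \<in> S" for x
  proof -
    have "(radial_map C \<Omega> has_derivative (\<lambda>v. v + (thickness C \<Omega> x *\<^sub>R N' x v + (\<psi> x \<bullet> v) *\<^sub>R outward_normal C x))) (at x within frontier C)"
      unfolding radial_map_def[abs_def]
      by (intro has_derivative_add has_derivative_ident has_derivative_scaleR D\<nu>[OF that] Dd[OF that])
    then show ?thesis using \<nu>N[OF that] unfolding d_def \<nu>_def by simp
  qed
  have eq: "z x \<bullet> (v + A x v) = a x * (G x \<bullet> v)" if x: "x \<in> S" and v: "N x \<bullet> v = 0" for x v
  proof -
    \<comment> \<open>The normal \<open>n x\<close> is frozen while \<open>y\<close> moves. The same
      function then has derivative \<open>0\<close> and the derivative computed from
      \<open>Dradial\<close>, and the two agree at the tangent vector \<open>v\<close>.\<close>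
    have "((\<lambda>y. n x \<bullet> radial_map C \<Omega> y) has_derivative (\<lambda>_. 0)) (at x within frontier C)"
      by (rule inward_normal_component_has_derivative_zero[OF inn[OF x] open_domain[OF core dom c] _ Dradial[OF x]])
         (rule radial_map_frontier(1)[OF core dom])
    from has_derivative_frontier_unique[OF core SD(1)[OF x] _ has_derivative_inner_right[OF Dradial[OF x], of "n x"] this, of v]
    have "n x \<bullet> (v + (d x *\<^sub>R N' x v + (\<psi> x \<bullet> v) *\<^sub>R N x)) = 0" using T[OF x] v by blast
    then show ?thesis
      unfolding nz A_def using v Nz[OF x] NN[OF x] NN'[OF x, of v] G\<psi>[OF v]
      by (simp add: inner_diff_left inner_diff_right inner_add_right inner_commute blinfun.scaleR_left algebra_simps)
  qed
  have a1: "a x \<le> 1" if "x \<in> S" for x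
    using az[OF that] by (smt (verit) one_power2 power2_le_imp_le zero_le_power2)
  have zG: "norm (z x) \<le> norm (G x)" if x: "x \<in> S" for x
  proof -
    \<comment> \<open>The equation is tested with \<open>v = z x\<close>, where positivity of
      \<open>A x\<close> drops the curvature term.\<close>
    have "norm (z x) * norm (z x) = z x \<bullet> z x" by (simp add: dot_square_norm power2_eq_square)
    also have "\<dots> \<le> z x \<bullet> (z x + A x (z x))"
      using psd[OF x Nz[OF x]] dpos[OF x] unfolding A_def
      by (simp add: inner_add_right blinfun.scaleR_left inner_commute)
    also have "\<dots> = a x * (G x \<bullet> z x)" by (rule eq[OF x Nz[OF x]])
    also have "\<dots> \<le> a x * (norm (G x) * norm (z x))" using a0[OF x] by (intro mult_left_mono norm_cauchy_schwarz)
    also have "\<dots> \<le> 1 * (norm (G x) * norm (z x))" using a1[OF x] by (intro mult_right_mono) auto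
    finally show ?thesis by (cases "z x = 0") (auto simp: mult_le_cancel_right)
  qed

  \<comment> \<open>\<open>L\<close> is \<open>I - d S\<close> extended to the ambient space. It
    keeps the normal component of every vector, so its kernel is tangent, and on tangent vectors it
    is positive definite.\<close>
  define L where "L = (\<lambda>v. v + A c v)"
  have NL: "N c \<bullet> L v = N c \<bullet> v" for v
    unfolding L_def A_def using NN'[OF cS] by (simp add: inner_add_right blinfun.scaleR_left)
  have linL: "linear L" unfolding L_def
    by (intro linear_compose_add linear_ident bounded_linear.linear blinfun.bounded_linear_right)
  have Apsd: "0 \<le> A c v \<bullet> v" if "N c \<bullet> v = 0" for v
    unfolding A_def using psd[OF cS that] dpos[OF cS] by (simp add: blinfun.scaleR_left)
  have "inj L"
  proof (subst linear_injective_0[OF linL], intro allI impI)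
    fix v assume L0: "L v = 0"
    then have "N c \<bullet> v = 0" using NL[of v] by simp
    then have "0 \<le> A c v \<bullet> v" by (rule Apsd)
    moreover have "v \<bullet> v + A c v \<bullet> v = 0" using L0 unfolding L_def by (metis inner_add_left inner_zero_left)
    ultimately show "v = 0" by (metis add_nonneg_eq_0_iff inner_eq_zero_iff inner_ge_zero)
  qed
  then obtain R where R: "linear R" "\<And>v. L (R v) = v" using linear_injective_isomorphism[OF linL] by blast
  \<comment> \<open>Projecting by \<open>P\<close> makes \<open>Z v\<close> tangent for every
    ambient \<open>v\<close>, not only for tangent \<open>v\<close>.\<close>
  define Z where "Z = (\<lambda>v. R (P (G' v)))"
  have linP: "linear P" unfolding P_def by (intro linearI) (auto simp: algebra_simps inner_simps)
  have linZ: "linear Z"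
    using linear_compose[OF linear_compose[OF G'.linear linP] R(1)] unfolding Z_def o_def by simp
  have LZ: "Z v + A c (Z v) = P (G' v)" for v using R(2)[of "P (G' v)"] unfolding Z_def L_def by simp
  have NZ: "N c \<bullet> Z v = 0" for v
    using NL[of "Z v"] LZ[of v] NN[OF cS] unfolding L_def P_def by (simp add: inner_diff_right)

  have contd: "(d \<longlongrightarrow> d c) (at c within S)"
    using has_derivative_continuous[OF Dd[OF cS]] unfolding atS d_def continuous_within by simp
  have contN: "(N \<longlongrightarrow> N c) (at c within S)"
    using has_derivative_continuous[OF bspec[OF N(1) U(2)]] unfolding continuous_within
    by (rule tendsto_within_subset) simp
  have contN': "(N' \<longlongrightarrow> N' c) (at c within S)"
    using N(2) U unfolding continuous_on_eq_continuous_at[OF U(1)] continuous_within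
    by (meson subset_UNIV tendsto_within_subset)
  have Dz: "(z has_derivative Z) (at c within S)"
  proof (rule tangential_solution_has_derivative[of c S N A G G' z a Z])
    show "continuous (at c within S) A" unfolding A_def continuous_within by (intro tendsto_intros contd contN')
    show "continuous (at c within S) N" unfolding continuous_within by (rule contN)
    show "(G has_derivative G') (at c within S)" by (rule has_derivative_at_withinI[OF DG])
    show "bounded_linear Z" using linZ by (simp add: linear_linear)
    show "(Z h + A c (Z h)) \<bullet> v = G' h \<bullet> v" if "N c \<bullet> v = 0" for h v
      unfolding LZ P_def using that by (simp add: inner_diff_left)
    show "A c u \<bullet> v = u \<bullet> A c v" if "N c \<bullet> u = 0" "N c \<bullet> v = 0" for u v
      unfolding A_def using N(5) SD[OF cS] T[OF cS] that by (simp add: blinfun.scaleR_left)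
    show "N c \<bullet> A c v = 0" for v unfolding A_def using NN'[OF cS] by (simp add: blinfun.scaleR_left)
  qed (use cS Gc normN Nz NG a0 az eq zG NZ Apsd in blast)+

  have zc: "z c = 0" using zG[OF cS] Gc by simp
  have ac: "a c = 1" using az[OF cS] a0[OF cS] zc by (simp add: power2_eq_1_iff)
  have zlim: "(z \<longlongrightarrow> 0) (at c within S)"
    using has_derivative_continuous[OF Dz] zc by (simp add: continuous_within)
  have alim: "(a \<longlongrightarrow> 1) (at c within S)"
  proof -
    have "((\<lambda>x. sqrt (1 - (norm (z x))\<^sup>2)) \<longlongrightarrow> sqrt (1 - (norm (0::'a))\<^sup>2)) (at c within S)"
      by (intro tendsto_intros zlim)
    moreover have "sqrt (1 - (norm (z x))\<^sup>2) = a x" if "x \<in> S" for x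
      using az[OF that] a0[OF that] by (metis add_diff_cancel_right' real_sqrt_abs abs_of_nonneg)
    ultimately show ?thesis
      by (subst tendsto_cong[of _ "\<lambda>x. sqrt (1 - (norm (z x))\<^sup>2)"]) (auto simp: eventually_at_filter)
  qed
  have nlim: "(n \<longlongrightarrow> - N c) (at c within S)"
  proof -
    have "((\<lambda>x. z x - a x *\<^sub>R N x) \<longlongrightarrow> 0 - 1 *\<^sub>R N c) (at c within S)"
      by (intro tendsto_intros zlim alim contN)
    then show ?thesis unfolding nz[symmetric] by simp
  qed
  have rlim: "(radial_map C \<Omega> \<longlongrightarrow> c + d c *\<^sub>R N c) (at c within S)"
    using has_derivative_continuous[OF Dradial[OF cS]] \<nu>N[OF cS] unfolding atS continuous_within radial by simp
  \<comment> \<open>\<open>F x\<close> lies in the half-space supporting \<open>C\<close> at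
    \<open>c\<close>, and a ray of unit speed needs at least the height of \<open>\<Phi> x\<close>
    above that plane to reach it.\<close>
  have tle: "N c \<bullet> (radial_map C \<Omega> x - c) \<le> t x" if x: "x \<in> S" for x
  proof -
    have "N c \<bullet> (radial_map C \<Omega> x + t x *\<^sub>R n x - c) \<le> 0"
      using outward_normal_supporting[OF core c return_map_mem[OF core dom SD(1)[OF x]]] \<nu>N[OF cS]
      unfolding return_map_eq t_def n_def \<nu>_def by simp
    then have "N c \<bullet> (radial_map C \<Omega> x - c) \<le> t x * - (N c \<bullet> n x)"
      by (simp add: inner_diff_right inner_add_right)
    also have "\<dots> \<le> t x * 1"
    proof (rule mult_left_mono)
      have "norm (n x) = 1" using inn[OF x] unfolding is_inward_normal_def by blast
      then show "- (N c \<bullet> n x) \<le> 1" using Cauchy_Schwarz_ineq2[of "N c" "n x"] normN[OF cS] by simp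
      show "0 \<le> t x" unfolding t_def by (rule return_time_nonneg[OF core dom SD(1)[OF x]])
    qed
    finally show ?thesis by simp
  qed
  have tlim: "(t \<longlongrightarrow> d c) (at c within S)"
  proof (rule order_tendstoI)
    fix l assume l: "l < d c"
    have "((\<lambda>x. N c \<bullet> (radial_map C \<Omega> x - c)) \<longlongrightarrow> N c \<bullet> (c + d c *\<^sub>R N c - c)) (at c within S)"
      by (intro tendsto_intros rlim)
    then have "eventually (\<lambda>x. l < N c \<bullet> (radial_map C \<Omega> x - c)) (at c within S)"
      using l NN[OF cS] by (intro order_tendstoD(1)) auto
    moreover have "eventually (\<lambda>x. x \<in> S) (at c within S)" by (simp add: eventually_at_filter)
    ultimately show "eventually (\<lambda>x. l < t x) (at c within S)"
      by eventually_elim (use tle in force)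
  next
    fix u assume u: "d c < u"
    \<comment> \<open>For the upper bound the limiting ray is followed a little past
      \<open>c\<close>, into the interior of \<open>C\<close>. By openness the nearby rays are then
      in \<open>C\<close> at time \<open>d c + s\<close> as well.\<close>
    obtain s1 where s1: "s1 > 0" "\<And>s. 0 < s \<Longrightarrow> s \<le> s1 \<Longrightarrow> c - s *\<^sub>R outward_normal C c \<in> interior C"
      using inward_ray_meets_interior[OF core c] by blast
    define s where "s = min s1 ((u - d c) / 2)"
    have s: "0 < s" "s \<le> s1" "d c + s < u" unfolding s_def using s1 u by (auto simp: min_def field_simps)
    have "((\<lambda>x. radial_map C \<Omega> x + (d c + s) *\<^sub>R n x) \<longlongrightarrow> c + d c *\<^sub>R N c + (d c + s) *\<^sub>R (- N c)) (at c within S)"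
      by (intro tendsto_intros rlim nlim)
    moreover have lim: "c + d c *\<^sub>R N c + (d c + s) *\<^sub>R (- N c) = c - s *\<^sub>R outward_normal C c"
      using \<nu>N[OF cS] unfolding \<nu>_def by (simp add: algebra_simps)
    ultimately have "eventually (\<lambda>x. radial_map C \<Omega> x + (d c + s) *\<^sub>R n x \<in> interior C) (at c within S)"
      using s1(2)[OF s(1,2)] unfolding lim[symmetric] by (metis topological_tendstoD open_interior)
    moreover have "eventually (\<lambda>x. x \<in> S) (at c within S)" by (simp add: eventually_at_filter)
    ultimately show "eventually (\<lambda>x. t x < u) (at c within S)"
    proof eventually_elim
      case (elim x)
      then have "t x \<le> d c + s"
        unfolding t_def n_def using return_time_le[OF core dom SD(1)[OF elim(2)]] dpos[OF cS] s interior_subset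
        by (metis add_nonneg_nonneg less_imp_le subsetD)
      then show ?case using s by simp
    qed
  qed
  \<comment> \<open>The limit just shown says nothing about the point \<open>c\<close> itself, whose
    value is required for \<open>\<tau> c = 0\<close>.\<close>
  have tc: "t c = d c"
  proof (rule antisym)
    show "d c \<le> t c" using tle[OF cS] NN[OF cS] \<nu>N[OF cS] unfolding radial by simp
    have "radial_map C \<Omega> c + d c *\<^sub>R exit_normal C \<Omega> c = c"
      using nz[of c] zc ac \<nu>N[OF cS] unfolding radial n_def by simp
    then show "t c \<le> d c"
      unfolding t_def using dpos[OF cS] frontier_convex_coreD(1)[OF core c]
      by (intro return_time_le[OF core dom c]) auto
  qed
  define \<tau> where "\<tau> = (\<lambda>x. d x - t x * a x)"
  have DF: "(return_map C \<Omega> has_derivative (\<lambda>v. v + d c *\<^sub>R Z v)) (at c within S)"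
  proof (rule normal_remainder_negligible[where N = N and z = z and t = t and \<tau> = \<tau> and M = "frontier C" and \<nu> = "N c"])
    have "((\<lambda>x. d x - t x * a x) \<longlongrightarrow> d c - d c * 1) (at c within S)"
      by (intro tendsto_intros contd tlim alim)
    then show "(\<tau> \<longlongrightarrow> 0) (at c within S)" unfolding \<tau>_def by simp
    show "\<tau> c = 0" unfolding \<tau>_def using tc ac by simp
    show "return_map C \<Omega> x = x + \<tau> x *\<^sub>R N x + t x *\<^sub>R z x" if "x \<in> S" for x
      unfolding return_map_eq radial t_def[symmetric] n_def[symmetric] nz \<nu>N[OF that] \<tau>_def by (simp add: algebra_simps)
    show "return_map C \<Omega> x \<in> frontier C" if "x \<in> S" for x by (rule return_map_frontier[OF core dom SD(1)[OF that]])
    show "((\<lambda>y. N c \<bullet> y) has_derivative (\<lambda>_. 0)) (at c within frontier C)"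
      using outward_normal_component_has_derivative_zero[OF core c] \<nu>N[OF cS] unfolding \<nu>_def by simp
    show "S \<subseteq> frontier C" unfolding S_def by blast
  qed (fact cS contN normN[OF cS] Dz zc NZ tlim | rule normN, assumption)+

  show thesis
  proof (rule that)
    show "(return_map C \<Omega> has_derivative (\<lambda>v. v + thickness C \<Omega> c *\<^sub>R Z v)) (at c within frontier C)"
      using DF unfolding atS d_def .
    show ZT: "Z v \<in> tangent_space C c" for v using T[OF cS] NZ by blast
    fix v assume v: "v \<in> tangent_space C c"
    have "shape_operator C c (Z v) = - N' c (Z v)"
      unfolding shape_operator_def using frechet_derivative_frontier[OF core c ZT D\<nu>[OF cS]] by simp
    then show "Z v - thickness C \<Omega> c *\<^sub>R shape_operator C c (Z v) = thickness_hessian C \<Omega> c v"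
      using LZ[of v] unfolding hess[OF v] A_def d_def by (simp add: blinfun.scaleR_left)
  next
    \<comment> \<open>Off the tangent space the values depend on the derivative selected by
      \<open>frechet_derivative\<close>, but every such selection is linear.\<close>
    have "linear (frechet_derivative (surface_gradient C (thickness C \<Omega>)) (at c within frontier C))"
      using Dsg by (intro linear_frechet_derivative) (auto simp: differentiable_def)
    then show "linear (thickness_hessian C \<Omega> c)"
      unfolding surface_hessian_def Let_def
      by (intro linearI) (simp_all add: linear_add linear_cmul algebra_simps inner_simps)
  qed
qed

section \<open>The geometric operator and the linearization formula\<close>

lemma subspace_tangent_space: "subspace (tangent_space C c)"
  unfolding tangent_space_def by (rule subspace_hyperplane)

text \<open>\<open>I + d D\<close> preserves the normal component and is injective, so its ambient
  inverse \<open>R\<close> restricts to the tangent space and coincides there with the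
  \<open>inv_into\<close> of the definition. One \<open>R\<close> serves all
  \<open>\<kappa>\<close>, which enters as a scalar factor.\<close>

lemma geometric_operator_resolvent:
  assumes C: "convex_core C" "c \<in> frontier C" and d: "0 \<le> thickness C \<Omega> c"
  obtains R where "linear R"
    "\<And>v. v \<in> tangent_space C c \<Longrightarrow> R v \<in> tangent_space C c"
    "\<And>v. v \<in> tangent_space C c \<Longrightarrow> R (v - thickness C \<Omega> c *\<^sub>R shape_operator C c v) = v"
    "\<And>v. v \<in> tangent_space C c \<Longrightarrow> R v = 0 \<Longrightarrow> v = 0"
    "\<And>\<kappa> v. v \<in> tangent_space C c \<Longrightarrow>
       geometric_operator \<kappa> C \<Omega> c v = (\<kappa> * thickness C \<Omega> c) *\<^sub>R R v"
proof -
  define T where "T = tangent_space C c"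
  define d where "d = thickness C \<Omega> c"
  obtain D where D: "linear D" "\<And>v. outward_normal C c \<bullet> D v = 0"
    "\<And>v. v \<in> T \<Longrightarrow> shape_operator C c v = - D v" "\<And>v. v \<in> T \<Longrightarrow> 0 \<le> D v \<bullet> v"
    using shape_operator_derivative[OF C] unfolding T_def by blast
  have T: "v \<in> T \<longleftrightarrow> outward_normal C c \<bullet> v = 0" for v unfolding T_def tangent_space_def by simp
  define L where "L = (\<lambda>v. v + d *\<^sub>R D v)"
  have linL: "linear L" unfolding L_def
    by (intro linear_compose_add linear_ident linear_compose_scale_right D)
  have NL: "outward_normal C c \<bullet> L v = outward_normal C c \<bullet> v" for v
    unfolding L_def using D(2) by (simp add: inner_add_right)
  have "inj L"
  proof (subst linear_injective_0[OF linL], intro allI impI)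
    fix v assume L0: "L v = 0"
    then have "v \<in> T" using NL[of v] T by simp
    then have "0 \<le> d * (D v \<bullet> v)" using D(4) \<open>0 \<le> thickness C \<Omega> c\<close> unfolding d_def by simp
    moreover have "v \<bullet> v + d * (D v \<bullet> v) = 0"
      using L0 unfolding L_def by (metis inner_add_left inner_scaleR_left inner_zero_left)
    ultimately show "v = 0" by (metis add_nonneg_eq_0_iff inner_eq_zero_iff inner_ge_zero)
  qed
  then obtain R where R: "linear R" "\<And>v. R (L v) = v" "\<And>v. L (R v) = v"
    using linear_injective_isomorphism[OF linL] by blast
  have RT: "R v \<in> T" if "v \<in> T" for v using that NL[of "R v"] R(3) T by simp
  have opL: "w - d *\<^sub>R shape_operator C c w = L w" if "w \<in> T" for w
    unfolding L_def D(3)[OF that] by simp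
  have inv: "inv_into T (\<lambda>w. w - d *\<^sub>R shape_operator C c w) v = R v" if "v \<in> T" for v
  proof (rule inv_into_f_eq)
    show "inj_on (\<lambda>w. w - d *\<^sub>R shape_operator C c w) T"
      by (rule inj_onI) (metis opL R(2))
    show "R v \<in> T" by (rule RT[OF that])
    show "R v - d *\<^sub>R shape_operator C c (R v) = v" using opL[OF RT[OF that]] R(3) by simp
  qed
  show thesis
  proof (rule that[OF R(1)])
    show "R v \<in> tangent_space C c" if "v \<in> tangent_space C c" for v using RT that unfolding T_def .
    show "R (v - thickness C \<Omega> c *\<^sub>R shape_operator C c v) = v" if "v \<in> tangent_space C c" for v
      using opL[of v] that R(2) unfolding T_def d_def by simp
    show "v = 0" if "R v = 0" for v using R(3)[of v] that linear_0[OF linL] by simp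
    show "geometric_operator \<kappa> C \<Omega> c v = (\<kappa> * thickness C \<Omega> c) *\<^sub>R R v" if "v \<in> tangent_space C c" for \<kappa> v
      using inv[of v] that unfolding geometric_operator_def T_def d_def by simp
  qed
qed

text \<open>Applying the resolvent to the equation for \<open>Z\<close> gives
  \<open>Z = R Hess d\<close> on tangent vectors. The plus sign in \<open>I + d R Hess d\<close> is
  the source of the constant \<open>-1\<close>.\<close>

lemma linearization_at_critical_point:
  assumes C: "convex_core C" and dom: "C2_domain C \<Omega>" and crit: "nondegenerate_critical_point C \<Omega> c"
  shows return_map_differentiable: "return_map C \<Omega> differentiable (at c within frontier C)"
    and linearization_formula_return_map: "linearization_formula (-1) C \<Omega> c"
    and linear_thickness_hessian: "linear (thickness_hessian C \<Omega> c)"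
proof -
  have c: "c \<in> frontier C" and g0: "surface_gradient C (thickness C \<Omega>) c = 0"
    using crit unfolding nondegenerate_critical_point_def by auto
  obtain Z where Z:
    "(return_map C \<Omega> has_derivative (\<lambda>v. v + thickness C \<Omega> c *\<^sub>R Z v)) (at c within frontier C)"
    "\<And>v. v \<in> tangent_space C c \<Longrightarrow> Z v \<in> tangent_space C c"
    "\<And>v. v \<in> tangent_space C c \<Longrightarrow>
       Z v - thickness C \<Omega> c *\<^sub>R shape_operator C c (Z v) = thickness_hessian C \<Omega> c v"
    and lin: "linear (thickness_hessian C \<Omega> c)"
    using return_map_has_derivative[OF C dom c g0] by blast
  obtain R where R: "linear R"
    "\<And>v. v \<in> tangent_space C c \<Longrightarrow> R (v - thickness C \<Omega> c *\<^sub>R shape_operator C c v) = v"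
    "\<And>\<kappa> v. v \<in> tangent_space C c \<Longrightarrow>
       geometric_operator \<kappa> C \<Omega> c v = (\<kappa> * thickness C \<Omega> c) *\<^sub>R R v"
    using geometric_operator_resolvent[OF C c less_imp_le[OF thickness_pos[OF C dom c]]] by metis
  show "return_map C \<Omega> differentiable (at c within frontier C)" using Z(1) by (auto simp: differentiable_def)
  show "linear (thickness_hessian C \<Omega> c)" by (rule lin)
  have HT: "thickness_hessian C \<Omega> c v \<in> tangent_space C c" if "v \<in> tangent_space C c" for v
    using crit that unfolding nondegenerate_critical_point_def by (auto dest: bij_betwE)
  show "linearization_formula (-1) C \<Omega> c"
    unfolding linearization_formula_def
  proof
    fix v assume v: "v \<in> tangent_space C c"
    have "R (thickness_hessian C \<Omega> c v) = Z v" using R(2)[OF Z(2)[OF v]] Z(3)[OF v] by simp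
    then show "return_differential C \<Omega> c v = v - geometric_operator (-1) C \<Omega> c (thickness_hessian C \<Omega> c v)"
      unfolding frechet_derivative_frontier[OF C c v Z(1)] R(3)[OF HT[OF v]] by simp
  qed
qed

section \<open>Eigenvectors\<close>

text \<open>Alignment is the same condition for all nonzero \<open>\<kappa>\<close>, as the
  operators are multiples of each other. The eigenvalues \<open>\<alpha>\<close> scale with
  \<open>\<kappa>\<close>, so their relation is tied to the linearization formula for that constant.
  Domains are compared at equal thickness because the geometric operator depends on
  \<open>d c\<close>.\<close>

theorem theorem8p6:
  fixes C \<Omega> :: "'a::euclidean_space set" and c :: 'a and \<kappa> :: real
  assumes "convex_core C"
    and "C2_domain C \<Omega>"
    and "nondegenerate_critical_point C \<Omega> c"
    and "\<kappa> \<noteq> 0"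
    and "simultaneously_diagonalizable_on (tangent_space C c)
           (geometric_operator \<kappa> C \<Omega> c) (thickness_hessian C \<Omega> c)"
  shows
    "return_map C \<Omega> differentiable (at c within frontier C) \<and>
     linearization_formula (-1) C \<Omega> c \<and>
     (\<forall>\<Omega>'. C2_domain C \<Omega>' \<and> nondegenerate_critical_point C \<Omega>' c \<and>
        thickness C \<Omega>' c = thickness C \<Omega> c \<and>
        (\<forall>v\<in>tangent_space C c. return_differential C \<Omega>' c v = return_differential C \<Omega> c v)
        \<longrightarrow> (\<forall>v. eigenvector_on (tangent_space C c) (thickness_hessian C \<Omega>' c) v
               \<longleftrightarrow> eigenvector_on (tangent_space C c) (thickness_hessian C \<Omega> c) v)) \<and>
     (\<forall>\<mu> v. v \<in> tangent_space C c \<and> v \<noteq> 0 \<and> return_differential C \<Omega> c v = \<mu> *\<^sub>R v \<and>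
        dim {w\<in>tangent_space C c. return_differential C \<Omega> c w = \<mu> *\<^sub>R w} = 1
        \<longrightarrow> eigenvector_on (tangent_space C c) (thickness_hessian C \<Omega> c) v) \<and>
     (linearization_formula \<kappa> C \<Omega> c \<longrightarrow>
       (\<forall>B \<alpha> lam. eigenbasis_on (tangent_space C c) (geometric_operator \<kappa> C \<Omega> c) B \<alpha> \<and>
          eigenbasis_on (tangent_space C c) (thickness_hessian C \<Omega> c) B lam
          \<longrightarrow> eigenbasis_on (tangent_space C c) (return_differential C \<Omega> c) B
                (\<lambda>b. 1 - \<alpha> b * lam b)))"
proof (intro conjI allI impI)
  note C = assms(1) and dom = assms(2) and crit = assms(3)
  define T where "T = tangent_space C c"
  define d where "d = thickness C \<Omega> c"
  define H where "H = thickness_hessian C \<Omega> c"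
  have c: "c \<in> frontier C" using crit unfolding nondegenerate_critical_point_def by blast
  have d: "0 < d" unfolding d_def by (rule thickness_pos[OF C dom c])
  obtain R where R: "linear R" "\<And>v. v \<in> T \<Longrightarrow> R v \<in> T" "\<And>v. v \<in> T \<Longrightarrow> R v = 0 \<Longrightarrow> v = 0"
    and A: "\<And>\<kappa> v. v \<in> T \<Longrightarrow> geometric_operator \<kappa> C \<Omega> c v = (\<kappa> * d) *\<^sub>R R v"
    using geometric_operator_resolvent[OF C c less_imp_le[OF thickness_pos[OF C dom c]]] unfolding T_def d_def by metis
  have linH: "linear H" unfolding H_def by (rule linear_thickness_hessian[OF C dom crit])
  have subT: "subspace T" unfolding T_def by (rule subspace_tangent_space)
  have HT: "thickness_hessian C \<Omega>' c v \<in> T" if "nondegenerate_critical_point C \<Omega>' c" "v \<in> T" for \<Omega>' v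
    using that unfolding nondegenerate_critical_point_def T_def by (auto dest: bij_betwE)
  have DF: "return_differential C \<Omega> c v = v + d *\<^sub>R R (H v)" if "v \<in> T" for v
    using linearization_formula_return_map[OF C dom crit] that A[OF HT[OF crit that]]
    unfolding linearization_formula_def T_def H_def by simp
  show "return_map C \<Omega> differentiable (at c within frontier C)" by (rule return_map_differentiable[OF C dom crit])
  show "linearization_formula (-1) C \<Omega> c" by (rule linearization_formula_return_map[OF C dom crit])
  {
    fix \<Omega>' v
    assume \<Omega>': "C2_domain C \<Omega>' \<and> nondegenerate_critical_point C \<Omega>' c \<and>
        thickness C \<Omega>' c = thickness C \<Omega> c \<and>
        (\<forall>v\<in>tangent_space C c. return_differential C \<Omega>' c v = return_differential C \<Omega> c v)"
    have same: "thickness_hessian C \<Omega>' c w = H w" if w: "w \<in> T" for w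
    proof -
      have crit': "nondegenerate_critical_point C \<Omega>' c" using \<Omega>' by blast
      have "geometric_operator (-1) C \<Omega>' c = geometric_operator (-1) C \<Omega> c"
        using \<Omega>' unfolding geometric_operator_def[abs_def] by simp
      then have "return_differential C \<Omega>' c w = w + d *\<^sub>R R (thickness_hessian C \<Omega>' c w)"
        using linearization_formula_return_map[OF C _ crit'] \<Omega>' w A[OF HT[OF crit' w]]
        unfolding linearization_formula_def T_def by simp
      then have "d *\<^sub>R R (thickness_hessian C \<Omega>' c w) = d *\<^sub>R R (H w)"
        using \<Omega>' w DF[OF w] unfolding T_def by auto
      then have "R (thickness_hessian C \<Omega>' c w - H w) = 0" using d by (simp add: linear_diff[OF R(1)])
      moreover have "thickness_hessian C \<Omega>' c w - H w \<in> T"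
        using HT[OF crit' w] HT[OF crit w] subT unfolding H_def by (intro subspace_diff)
      ultimately have "thickness_hessian C \<Omega>' c w - H w = 0" using R(3) by blast
      then show ?thesis by simp
    qed
    then show "eigenvector_on (tangent_space C c) (thickness_hessian C \<Omega>' c) v
               \<longleftrightarrow> eigenvector_on (tangent_space C c) (thickness_hessian C \<Omega> c) v"
      unfolding eigenvector_on_def T_def H_def by auto
  next
    fix \<mu> v
    assume v: "v \<in> tangent_space C c \<and> v \<noteq> 0 \<and> return_differential C \<Omega> c v = \<mu> *\<^sub>R v \<and>
        dim {w\<in>tangent_space C c. return_differential C \<Omega> c w = \<mu> *\<^sub>R w} = 1"
    obtain B l m where B: "span B = T" "\<And>b. b \<in> B \<Longrightarrow> geometric_operator \<kappa> C \<Omega> c b = l b *\<^sub>R b"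
      "\<And>b. b \<in> B \<Longrightarrow> H b = m b *\<^sub>R b"
      using assms(5) unfolding simultaneously_diagonalizable_on_def eigenbasis_on_def T_def H_def by blast
    \<comment> \<open>Up to the nonzero factor \<open>\<kappa> * d\<close>, \<open>R\<close> is the
      geometric operator; it is scalar on each vector of the common eigenbasis and hence commutes
      there with \<open>H\<close>.\<close>
    have comm: "R (H w) = H (R w)" if w: "w \<in> T" for w
    proof -
      have "(R \<circ> H) w = (H \<circ> R) w"
      proof (rule linear_eq_on_span[of "R \<circ> H" "H \<circ> R" B])
        fix b assume b: "b \<in> B"
        then have "b \<in> T" using B(1) span_base by blast
        then have "(\<kappa> * d) *\<^sub>R R b = l b *\<^sub>R b" using A B(2)[OF b] by simp
        then have "R b = (l b / (\<kappa> * d)) *\<^sub>R b" using assms(4) d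
          by (metis divide_inverse_commute mult_eq_0_iff order_less_irrefl scaleR_scaleR
              left_inverse scaleR_one)
        then show "(R \<circ> H) b = (H \<circ> R) b"
          by (simp add: B(3)[OF b] linear_cmul[OF R(1)] linear_cmul[OF linH] mult.commute)
      qed (use w B(1) R(1) linH in \<open>auto intro: linear_compose\<close>)
      then show ?thesis by simp
    qed
    define E where "E = {w\<in>T. return_differential C \<Omega> c w = \<mu> *\<^sub>R w}"
    have vE: "v \<in> T" "v + d *\<^sub>R R (H v) = \<mu> *\<^sub>R v" using v DF unfolding T_def by auto
    have HvT: "H v \<in> T" unfolding H_def by (rule HT[OF crit vE(1)])
    have "H (v + d *\<^sub>R R (H v)) = H (\<mu> *\<^sub>R v)" using vE(2) by simp
    then have "return_differential C \<Omega> c (H v) = \<mu> *\<^sub>R H v"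
      unfolding DF[OF HvT] comm[OF HvT] by (simp add: linear_add[OF linH] linear_cmul[OF linH])
    then have "H v \<in> E" using HvT unfolding E_def by simp
    \<comment> \<open>\<open>{v}\<close> is an independent subset of \<open>E\<close> with as many
      elements as the dimension of \<open>E\<close>, so it spans \<open>E\<close>.\<close>
    moreover have "E \<subseteq> span {v}"
      by (rule card_ge_dim_independent) (use v in \<open>auto simp: E_def T_def\<close>)
    ultimately obtain k where "H v = k *\<^sub>R v" by (auto simp: span_singleton)
    then show "eigenvector_on (tangent_space C c) (thickness_hessian C \<Omega> c) v"
      using v unfolding eigenvector_on_def H_def by blast
  next
    fix B \<alpha> lam
    assume lf: "linearization_formula \<kappa> C \<Omega> c"
      and "eigenbasis_on (tangent_space C c) (geometric_operator \<kappa> C \<Omega> c) B \<alpha> \<and>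
          eigenbasis_on (tangent_space C c) (thickness_hessian C \<Omega> c) B lam"
    then have B: "independent B" "span B = T" "\<And>b. b \<in> B \<Longrightarrow> geometric_operator \<kappa> C \<Omega> c b = \<alpha> b *\<^sub>R b"
      "\<And>b. b \<in> B \<Longrightarrow> H b = lam b *\<^sub>R b"
      unfolding eigenbasis_on_def T_def H_def by auto
    have "return_differential C \<Omega> c b = (1 - \<alpha> b * lam b) *\<^sub>R b" if b: "b \<in> B" for b
    proof -
      have bT: "b \<in> T" using b B(2) span_base by blast
      have "geometric_operator \<kappa> C \<Omega> c (lam b *\<^sub>R b) = lam b *\<^sub>R geometric_operator \<kappa> C \<Omega> c b"
        using A[OF bT] A[OF subspace_scale[OF subT bT]] by (simp add: linear_cmul[OF R(1)])
      moreover have "return_differential C \<Omega> c b = b - geometric_operator \<kappa> C \<Omega> c (H b)"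
        using lf bT unfolding linearization_formula_def T_def H_def by blast
      ultimately show ?thesis using B(3,4)[OF b] by (simp add: algebra_simps)
    qed
    then show "eigenbasis_on (tangent_space C c) (return_differential C \<Omega> c) B (\<lambda>b. 1 - \<alpha> b * lam b)"
      using B unfolding eigenbasis_on_def T_def by simp
  }
qed

end
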